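(* Assume (A1)–(A4) and fix $\delta>0$. For each $m\in\mathbb N$ let $\lambda^m_\delta$ be the constant of a solution $(w^m_\delta,\lambda^m_\delta)$ of the one-step equation (OS) on $B_m$ (such solutions exist, and $\lambda^m_\delta$ equals the optimal value of the dyadic impulse control problem with obligatory impulses outside $B_m$, hence is uniquely determined and non-decreasing in $m$), and set $\lambda_\delta:=\lim_{m\to\infty}\lambda^m_\delta$. If $\lambda_\delta>r(f)$, then there exists $w_\delta\in\mathcal C_b(E)$ with $\sup_{\xi\in U}w_\delta(\xi)=0$ such that \[ w_\delta(x)=\sup_{\tau\in\mathcal T^\delta_{x,b}}\ln\mathbb E_x\Big[e^{\int_0^\tau(f(X_s)-\lambda_\delta)ds+Mw_\delta(X_\tau)}\Big],\qquad x\in E. \]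
   Context: Setting: $X$ is a standard Feller–Markov process with values in a locally compact separable metric space $(E,\rho)$ with Borel $\sigma$-field $\mathcal E$; laws $\mathbb P_x$, expectations $\mathbb E_x$, $P_t(x,A)=\mathbb P_x[X_t\in A]$. $\mathcal C_b(E)$: bounded continuous functions. $\mathcal T^\delta_{x,b}$: $\mathbb P_x$-a.s. bounded stopping times with values in $\{0,\delta,2\delta,\dots\}\cup\{\infty\}$. $U\subseteq E$ compact; $(B_m)$ compact, $U\subset B_0$, $B_m\subset B_{m+1}$, $\bigcup B_m=E$. $Mh(x):=\sup_{\xi\in U}(c(x,\xi)+h(\xi))$. $r(f):=\lim_{t\to\infty}\frac1t\ln\sup_{x\in E}\mathbb E_x[e^{\int_0^tf(X_s)ds}]$. $\tau_{B_m}:=\delta\inf\{k\in\mathbb N:X_{k\delta}\notin B_m\}$. (OS) on $B_m$: $\lambda^m_\delta\in\mathbb R$, $w^m_\delta$ bounded continuous on $B_m$, $w^m_\delta=Mw^m_\delta$ off $B_m$, and for $x\in B_m$: $w^m_\delta(x)=\max\big(\ln\mathbb E_x[e^{\int_0^\delta(f(X_s)-\lambda^m_\delta)ds+1_{\{X_\delta\in B_m\}}w^m_\delta(X_\delta)+1_{\{X_\delta\notin B_m\}}Mw^m_\delta(X_\delta)}],\ Mw^m_\delta(x)\big)$. Standing assumptions: (A1) $f:E\to(-\infty,0]$ is continuous and bounded; $c:E\times U\to(-\infty,0]$ is continuous, bounded, and for some $c_0<0$: $0>c_0\ge c(x,\xi)\ge c(x,\eta)+c(\eta,\xi)$ for all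 $x\in E$, $\xi,\eta\in U$; moreover $\sup_{\xi\in U}|c(x,\xi)-c(y,\xi)|\to0$ as $x,y$ both tend to infinity (leave every compact set). (A2) For every $t>0$ and $x_n\to x$: $\sup_{A\in\mathcal E}|P_t(x_n,A)-P_t(x,A)|\to0$. (A3) For every compact $\Gamma\subset E$, $t_0>0$, $r_0>0$: $\lim_{r\to\infty}M_\Gamma(t_0,r)=0$ and $\lim_{t\to0}M_\Gamma(t,r_0)=0$, where $M_\Gamma(t,r):=\sup_{x\in\Gamma}\mathbb P_x[\sup_{s\in[0,t]}\rho(X_s,x)\ge r]$. (A4) For every $m$, $x\in B_m$, $\delta>0$ and open $\mathcal O\subset B_m$: $\mathbb P_x[\bigcup_{i\ge1}\{X_{i\delta}\in\mathcal O\}]=1$; and for all $x\in E$, $\delta>0$, $m$: $\mathbb P_x[\tau_{B_m}<\infty]=1$. *)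

theory Defs
  imports "HOL-Probability.Probability"
begin

text \<open>Common measurable path space M, laws Px x, process X (time real, t \<ge> 0).\<close>

definition natfilt :: "'w measure \<Rightarrow> (real \<Rightarrow> 'w \<Rightarrow> 'a::topological_space) \<Rightarrow> real \<Rightarrow> 'w measure" where
  "natfilt M X t = sigma (space M)
     {X s -` A \<inter> space M | s A. s \<in> {0..t} \<and> A \<in> sets borel}"

definition Ptrans :: "('a \<Rightarrow> 'w measure) \<Rightarrow> (real \<Rightarrow> 'w \<Rightarrow> 'a) \<Rightarrow> real \<Rightarrow> 'a \<Rightarrow> 'a set \<Rightarrow> real" where
  "Ptrans Px X t x A = measure (Px x) {\<omega> \<in> space (Px x). X t \<omega> \<in> A}"

definition C0 :: "('a::metric_space \<Rightarrow> real) set" where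
  "C0 = {g. continuous_on UNIV g \<and>
            (\<forall>\<epsilon>>0. \<exists>K. compact K \<and> (\<forall>x. x \<notin> K \<longrightarrow> \<bar>g x\<bar> \<le> \<epsilon>))}"

definition Cb :: "('a::metric_space \<Rightarrow> real) set" where
  "Cb = {g. continuous_on UNIV g \<and> bounded (range g)}"

definition standard_Feller_Markov ::
  "'w measure \<Rightarrow> ('a::metric_space \<Rightarrow> 'w measure) \<Rightarrow> (real \<Rightarrow> 'w \<Rightarrow> 'a) \<Rightarrow> bool" where
  "standard_Feller_Markov M Px X \<longleftrightarrow>
     (\<forall>x. prob_space (Px x) \<and> sets (Px x) = sets M) \<and>
     (\<forall>t\<ge>0. X t \<in> measurable M borel) \<and>
     (\<forall>x. AE \<omega> in Px x. X 0 \<omega> = x) \<and>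
     (\<forall>\<omega>\<in>space M. \<forall>t\<ge>0. continuous (at_right t) (\<lambda>s. X s \<omega>) \<and>
        (t > 0 \<longrightarrow> (\<exists>l. ((\<lambda>s. X s \<omega>) \<longlongrightarrow> l) (at_left t)))) \<and>
     (\<forall>x s t A F. 0 \<le> s \<longrightarrow> 0 \<le> t \<longrightarrow> A \<in> sets borel \<longrightarrow> F \<in> sets (natfilt M X s) \<longrightarrow>
        integral\<^sup>L (Px x) (\<lambda>\<omega>. indicator F \<omega> * indicator A (X (s + t) \<omega>)) =
        integral\<^sup>L (Px x) (\<lambda>\<omega>. indicator F \<omega> * Ptrans Px X t (X s \<omega>) A)) \<and>
     (\<forall>g\<in>C0. \<forall>t\<ge>0. (\<lambda>x. integral\<^sup>L (Px x) (\<lambda>\<omega>. g (X t \<omega>))) \<in> C0) \<and>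
     (\<forall>g\<in>C0. \<forall>x. ((\<lambda>t. integral\<^sup>L (Px x) (\<lambda>\<omega>. g (X t \<omega>))) \<longlongrightarrow> g x) (at_right 0))"

definition Mop :: "('a \<Rightarrow> 'a \<Rightarrow> real) \<Rightarrow> 'a set \<Rightarrow> ('a \<Rightarrow> real) \<Rightarrow> 'a \<Rightarrow> real" where
  "Mop c U h x = (SUP \<xi>\<in>U. c x \<xi> + h \<xi>)"

definition rate :: "('a \<Rightarrow> 'w measure) \<Rightarrow> (real \<Rightarrow> 'w \<Rightarrow> 'a) \<Rightarrow> ('a \<Rightarrow> real) \<Rightarrow> real" where
  "rate Px X f = Lim at_top (\<lambda>t. ln (SUP x. integral\<^sup>L (Px x)
        (\<lambda>\<omega>. exp (integral {0..t} (\<lambda>s. f (X s \<omega>))))) / t)"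

text \<open>Dyadic a.s. bounded stopping times T^delta_{x,b}; a stopping time is encoded by
  its multiplier sigma (tau = sigma * delta, sigma = \<infinity> meaning tau = \<infinity>).\<close>
definition dyadic_stopping_times ::
  "'w measure \<Rightarrow> ('a \<Rightarrow> 'w measure) \<Rightarrow> (real \<Rightarrow> 'w \<Rightarrow> 'a::topological_space) \<Rightarrow> real \<Rightarrow> 'a \<Rightarrow> ('w \<Rightarrow> enat) set" where
  "dyadic_stopping_times M Px X \<delta> x =
     {\<sigma>. (\<forall>k::nat. {\<omega> \<in> space M. \<sigma> \<omega> = enat k} \<in> sets (natfilt M X (real k * \<delta>))) \<and>
          (\<exists>N::nat. AE \<omega> in Px x. \<sigma> \<omega> \<le> enat N)}"

definition OS_solution ::
  "('a \<Rightarrow> 'w measure) \<Rightarrow> (real \<Rightarrow> 'w \<Rightarrow> 'a::metric_space) \<Rightarrow> ('a \<Rightarrow> real) \<Rightarrow> ('a \<Rightarrow> 'a \<Rightarrow> real) \<Rightarrow>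
     'a set \<Rightarrow> real \<Rightarrow> 'a set \<Rightarrow> real \<Rightarrow> ('a \<Rightarrow> real) \<Rightarrow> bool" where
  "OS_solution Px X f c U \<delta> B lam w \<longleftrightarrow>
     bounded (w ` B) \<and> continuous_on B w \<and>
     (\<forall>x. x \<notin> B \<longrightarrow> w x = Mop c U w x) \<and>
     (\<forall>x\<in>B. w x = max
        (ln (integral\<^sup>L (Px x) (\<lambda>\<omega>. exp (integral {0..\<delta>} (\<lambda>s. f (X s \<omega>) - lam)
             + (if X \<delta> \<omega> \<in> B then w (X \<delta> \<omega>) else Mop c U w (X \<delta> \<omega>))))))
        (Mop c U w x))"

definition A1 :: "('a::metric_space \<Rightarrow> real) \<Rightarrow> ('a \<Rightarrow> 'a \<Rightarrow> real) \<Rightarrow> 'a set \<Rightarrow> bool" where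
  "A1 f c U \<longleftrightarrow>
     continuous_on UNIV f \<and> bounded (range f) \<and> (\<forall>x. f x \<le> 0) \<and>
     continuous_on (UNIV \<times> U) (\<lambda>(x, \<xi>). c x \<xi>) \<and> bounded ((\<lambda>(x, \<xi>). c x \<xi>) ` (UNIV \<times> U)) \<and>
     (\<forall>x. \<forall>\<xi>\<in>U. c x \<xi> \<le> 0) \<and>
     (\<exists>c0<0. \<forall>x. \<forall>\<xi>\<in>U. \<forall>\<eta>\<in>U. c0 \<ge> c x \<xi> \<and> c x \<xi> \<ge> c x \<eta> + c \<eta> \<xi>) \<and>
     (\<forall>\<epsilon>>0. \<exists>K. compact K \<and>
        (\<forall>x y. x \<notin> K \<longrightarrow> y \<notin> K \<longrightarrow> (\<forall>\<xi>\<in>U. \<bar>c x \<xi> - c y \<xi>\<bar> \<le> \<epsilon>)))"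

definition A2 :: "('a::metric_space \<Rightarrow> 'w measure) \<Rightarrow> (real \<Rightarrow> 'w \<Rightarrow> 'a) \<Rightarrow> bool" where
  "A2 Px X \<longleftrightarrow> (\<forall>t>0. \<forall>x xn. xn \<longlonglongrightarrow> x \<longrightarrow>
     (\<lambda>n. SUP A\<in>sets borel. \<bar>Ptrans Px X t (xn n) A - Ptrans Px X t x A\<bar>) \<longlonglongrightarrow> 0)"

definition MGamma :: "('a::metric_space \<Rightarrow> 'w measure) \<Rightarrow> (real \<Rightarrow> 'w \<Rightarrow> 'a) \<Rightarrow> 'a set \<Rightarrow> real \<Rightarrow> real \<Rightarrow> real" where
  "MGamma Px X \<Gamma> t r = (SUP x\<in>\<Gamma>. measure (Px x)
      {\<omega> \<in> space (Px x). (SUP s\<in>{0..t}. dist (X s \<omega>) x) \<ge> r})"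

definition A3 :: "('a::metric_space \<Rightarrow> 'w measure) \<Rightarrow> (real \<Rightarrow> 'w \<Rightarrow> 'a) \<Rightarrow> bool" where
  "A3 Px X \<longleftrightarrow> (\<forall>\<Gamma> t0 r0. compact \<Gamma> \<longrightarrow> \<Gamma> \<noteq> {} \<longrightarrow> t0 > 0 \<longrightarrow> r0 > 0 \<longrightarrow>
     ((\<lambda>r. MGamma Px X \<Gamma> t0 r) \<longlongrightarrow> 0) at_top \<and>
     ((\<lambda>t. MGamma Px X \<Gamma> t r0) \<longlongrightarrow> 0) (at_right 0))"

definition A4 :: "('a::metric_space \<Rightarrow> 'w measure) \<Rightarrow> (real \<Rightarrow> 'w \<Rightarrow> 'a) \<Rightarrow> (nat \<Rightarrow> 'a set) \<Rightarrow> bool" where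
  "A4 Px X B \<longleftrightarrow>
     (\<forall>m x \<delta> V. x \<in> B m \<longrightarrow> \<delta> > 0 \<longrightarrow> open V \<longrightarrow> V \<noteq> {} \<longrightarrow> V \<subseteq> B m \<longrightarrow>
        measure (Px x) {\<omega> \<in> space (Px x). \<exists>i::nat. i \<ge> 1 \<and> X (real i * \<delta>) \<omega> \<in> V} = 1) \<and>
     (\<forall>x \<delta> m. \<delta> > 0 \<longrightarrow>
        measure (Px x) {\<omega> \<in> space (Px x). \<exists>k::nat. X (real k * \<delta>) \<omega> \<notin> B m} = 1)"

end

theory Submission
  imports Defs "HOL-Complex_Analysis.Great_Picard"
begin

text \<open>Let \<open>T\<close> be the Feynman-Kac operator \<open>\<phi> \<mapsto> E\<^sub>x[exp (\<integral>\<^sub>0\<^sup>d (f (X\<^sub>s) - \<lambda>) ds) \<phi> (X\<^sub>d)]\<close> and normalise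
  every one-step solution to have supremum \<open>0\<close> over \<open>U\<close>. For \<open>m\<close> large \<open>\<lambda>\<^sup>m\<close> stays above some
  \<open>l\<^sub>0 > r(f)\<close>, and then \<open>\<phi> = exp w\<^sup>m\<close> satisfies \<open>\<phi> \<le> 1 + T\<phi>\<close> with \<open>l\<^sub>0\<close> in place of \<open>\<lambda>\<close>; the powers
  of that \<open>T\<close> decay geometrically, so the \<open>w\<^sup>m\<close> are uniformly bounded. By (A2), \<open>T\<close> maps bounded
  families to equicontinuous ones: once the first short piece of the time interval is dropped from
  the exponential, at uniformly small cost, a transition operator is applied to a bounded function.
  Hence the functions \<open>max (ln (T (exp w\<^sup>m))) (M w\<^sup>m)\<close>, which agree with \<open>w\<^sup>m\<close> on \<open>B\<^sub>m\<close>, converge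
  locally uniformly along a subsequence, and the limit solves \<open>w = max (ln (T (exp w))) (M w)\<close> on
  all of \<open>E\<close>. Such a \<open>w\<close> is the value of the stopping problem: \<open>exp w\<close> dominates the payoff and is a
  supermartingale along the discounted process, and a martingale up to the first contact
  \<open>w = M w\<close>; capping that time at a large step costs little, again by the decay of the powers
  of \<open>T\<close>.\<close>

subsection \<open>Suprema, exponentials and discrete times\<close>

lemma abs_SUP_diff_le:
  fixes a b :: "'b \<Rightarrow> real"
  assumes "U \<noteq> {}" "bdd_above (b ` U)" "\<And>\<xi>. \<xi> \<in> U \<Longrightarrow> \<bar>a \<xi> - b \<xi>\<bar> \<le> e"
  shows "\<bar>(SUP \<xi>\<in>U. a \<xi>) - (SUP \<xi>\<in>U. b \<xi>)\<bar> \<le> e"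
proof -
  have a_le: "a \<xi> \<le> (SUP \<xi>\<in>U. b \<xi>) + e" if "\<xi> \<in> U" for \<xi>
    using cSUP_upper[OF that assms(2)] assms(3)[OF that] by linarith
  then have SUP_a_le: "(SUP \<xi>\<in>U. a \<xi>) \<le> (SUP \<xi>\<in>U. b \<xi>) + e" by (rule cSUP_least[OF assms(1)])
  have "bdd_above (a ` U)" using a_le by (rule bdd_aboveI2)
  then have "b \<xi> \<le> (SUP \<xi>\<in>U. a \<xi>) + e" if "\<xi> \<in> U" for \<xi>
    using cSUP_upper[OF that, of a] assms(3)[OF that] by linarith
  then have "(SUP \<xi>\<in>U. b \<xi>) \<le> (SUP \<xi>\<in>U. a \<xi>) + e"
    by (rule cSUP_least[OF assms(1)])
  with SUP_a_le show ?thesis by linarith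
qed

lemma uniform_limit_SUP:
  fixes v :: "'i \<Rightarrow> 'b \<Rightarrow> real"
  assumes "uniform_limit U v g G" "U \<noteq> {}" "bdd_above (g ` U)"
  shows "((\<lambda>n. SUP \<xi>\<in>U. v n \<xi>) \<longlongrightarrow> (SUP \<xi>\<in>U. g \<xi>)) G"
  unfolding tendsto_iff dist_real_def
proof (intro allI impI)
  fix \<epsilon> :: real assume "0 < \<epsilon>"
  then have "\<forall>\<^sub>F n in G. \<forall>\<xi>\<in>U. dist (v n \<xi>) (g \<xi>) < \<epsilon> / 2"
    using assms(1) by (intro uniform_limitD) auto
  then show "\<forall>\<^sub>F n in G. \<bar>(SUP \<xi>\<in>U. v n \<xi>) - (SUP \<xi>\<in>U. g \<xi>)\<bar> < \<epsilon>"
  proof eventually_elim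
    case (elim n)
    then have "\<bar>(SUP \<xi>\<in>U. v n \<xi>) - (SUP \<xi>\<in>U. g \<xi>)\<bar> \<le> \<epsilon> / 2"
      by (intro abs_SUP_diff_le assms) (auto simp: dist_real_def intro: less_imp_le)
    then show ?case using \<open>0 < \<epsilon>\<close> by simp
  qed
qed

lemma uniformly_continuous_on_ln_atLeast:
  assumes "0 < a"
  shows "uniformly_continuous_on {a..} (ln :: real \<Rightarrow> real)"
proof (rule lipschitz_on_uniformly_continuous)
  show "(1 / a)-lipschitz_on {a..} ln"
  proof (rule bounded_derivative_imp_lipschitz)
    show "(ln has_derivative (\<lambda>h. h * (1 / x))) (at x within {a..})" if "x \<in> {a..}" for x
      using that assms by (auto intro!: derivative_eq_intros simp: divide_inverse)
    show "onorm (\<lambda>h. h * (1 / x)) \<le> 1 / a" if "x \<in> {a..}" for x :: real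
      using that assms by (intro onorm_le) (auto simp: abs_mult divide_simps mult_left_mono)
  qed (use assms in auto)
qed

lemma abs_exp_mult_le:
  fixes a b p C :: real
  assumes "\<bar>a\<bar> \<le> b" "\<bar>p\<bar> \<le> C"
  shows "\<bar>exp a * p\<bar> \<le> exp b * C"
  unfolding abs_mult using assms by (intro mult_mono) auto

lemma abs_exp_diff_one_le:
  fixes a b :: real
  assumes "\<bar>a\<bar> \<le> b"
  shows "\<bar>exp a - 1\<bar> \<le> exp b - 1"
proof -
  have "1 - a \<le> exp (- a)" "exp (- a) \<le> exp b" "exp a \<le> exp b" "1 + a \<le> exp a"
    using assms exp_ge_add_one_self[of "- a"] exp_ge_add_one_self[of a] by auto
  then show ?thesis by linarith
qed

lemma measurable_enatI:
  assumes "\<And>k. {\<omega> \<in> space M. \<sigma> \<omega> = enat k} \<in> sets M"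
  shows "\<sigma> \<in> measurable M (count_space UNIV)"
proof (subst measurable_count_space_eq_countable, simp, intro conjI ballI)
  fix e :: enat
  have "e = \<infinity> \<longleftrightarrow> (\<forall>k. e \<noteq> enat k)" for e by (cases e) auto
  then have "\<sigma> -` {\<infinity>} \<inter> space M = space M - (\<Union>k. {\<omega> \<in> space M. \<sigma> \<omega> = enat k})" by auto
  then have "\<sigma> -` {\<infinity>} \<inter> space M \<in> sets M" using assms by simp
  moreover have "\<sigma> -` {enat k} \<inter> space M = {\<omega> \<in> space M. \<sigma> \<omega> = enat k}" for k by auto
  ultimately show "\<sigma> -` {e} \<inter> space M \<in> sets M" using assms by (cases e) simp_all
qed simp

lemma the_enat_min_le: "the_enat (min e (enat n)) \<le> n"
  by (cases e) (auto simp: min_def)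

lemma Least_eq_iff_first:
  fixes Q :: "nat \<Rightarrow> bool"
  assumes "Q n"
  shows "(LEAST k. Q k) = k \<longleftrightarrow> Q k \<and> (\<forall>j<k. \<not> Q j)"
  using assms by (metis LeastI not_less_Least Least_equality not_le)

subsection \<open>Riemann sums of right-continuous functions\<close>

definition right_riemann_sum :: "(real \<Rightarrow> real) \<Rightarrow> real \<Rightarrow> real \<Rightarrow> nat \<Rightarrow> real" where
  "right_riemann_sum h a t n = t / real n * (\<Sum>i=1..n. h (a + real i * (t / real n)))"

lemma has_integral_ceiling_step:
  fixes h :: "real \<Rightarrow> real"
  assumes d_pos: "0 < d"
  shows "((\<lambda>u. h (a + d * of_int \<lceil>(u - a) / d\<rceil>)) has_integral
    (d * (\<Sum>i=1..n. h (a + real i * d)))) {a..a + real n * d}"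
proof (induction n)
  case 0
  then show ?case by (simp add: has_integral_refl)
next
  case (Suc n)
  have "((\<lambda>u. h (a + real (Suc n) * d)) has_integral (d * h (a + real (Suc n) * d)))
      {a + real n * d..a + real (Suc n) * d}"
    using has_integral_const_real[of "h (a + real (Suc n) * d)" "a + real n * d"
      "a + real (Suc n) * d"] d_pos
    by (simp add: algebra_simps)
  then have "((\<lambda>u. h (a + d * of_int \<lceil>(u - a) / d\<rceil>)) has_integral (d * h (a + real (Suc n) * d)))
      {a + real n * d..a + real (Suc n) * d}"
  proof (rule has_integral_spike_finite[rotated 2])
    fix u assume "u \<in> {a + real n * d..a + real (Suc n) * d} - {a + real n * d}"
    then have "real n < (u - a) / d" "(u - a) / d \<le> real n + 1"
      using d_pos by (auto simp: field_simps)
    then have "\<lceil>(u - a) / d\<rceil> = int (Suc n)"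
      by (intro ceiling_unique) auto
    then show "h (a + d * of_int \<lceil>(u - a) / d\<rceil>) = h (a + real (Suc n) * d)"
      by (simp add: algebra_simps)
  qed simp
  from has_integral_combine[OF _ _ Suc.IH this] d_pos
  show ?case by (simp add: algebra_simps)
qed

lemma ceiling_grid_bounds:
  fixes a d u :: real
  assumes d_pos: "0 < d" and "u \<in> {a..a + real n * d}"
  shows "a + d * of_int \<lceil>(u - a) / d\<rceil> \<in> {u..a + real n * d}"
    and "a + d * of_int \<lceil>(u - a) / d\<rceil> \<le> u + d"
proof -
  define k where "k = real_of_int \<lceil>(u - a) / d\<rceil>"
  have "(u - a) / d \<le> real n" using assms by (simp add: field_simps)
  then have "k \<le> real n" unfolding k_def by (metis ceiling_le_iff of_int_le_iff of_int_of_nat_eq)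
  moreover have "(u - a) / d \<le> k" "k \<le> (u - a) / d + 1" unfolding k_def by linarith+
  ultimately show "a + d * of_int \<lceil>(u - a) / d\<rceil> \<in> {u..a + real n * d}"
    and "a + d * of_int \<lceil>(u - a) / d\<rceil> \<le> u + d"
    using d_pos unfolding k_def[symmetric] by (auto simp: field_simps)
qed

lemma continuous_at_right_LIMSEQ:
  fixes h :: "real \<Rightarrow> 'a::topological_space"
  assumes "continuous (at_right u) h" "\<And>n. u \<le> s n" "s \<longlonglongrightarrow> u"
  shows "(\<lambda>n. h (s n)) \<longlonglongrightarrow> h u"
proof -
  have "continuous (at u within {u..}) h"
    using assms(1) by (simp add: continuous_within at_within_Ici_at_right)
  then show ?thesis
    using assms(2,3) unfolding continuous_within_sequentially comp_def by auto
qed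

lemma
  fixes h :: "real \<Rightarrow> real"
  assumes t_pos: "0 < t"
    and right_continuous: "\<And>u. u \<in> {a..a + t} \<Longrightarrow> continuous (at_right u) h"
    and bounded: "\<And>u. u \<in> {a..a + t} \<Longrightarrow> \<bar>h u\<bar> \<le> C"
  shows right_continuous_integrable_on: "h integrable_on {a..a + t}"
    and right_riemann_sum_tendsto:
      "(\<lambda>n. right_riemann_sum h a t (Suc n)) \<longlonglongrightarrow> integral {a..a + t} h"
proof -
  define d where "d n = t / real (Suc n)" for n
  define step where "step n u = h (a + d n * of_int \<lceil>(u - a) / d n\<rceil>)" for n u
  have mesh: "0 < d n" "real (Suc n) * d n = t" for n using t_pos by (simp_all add: d_def)
  note grid = ceiling_grid_bounds[OF mesh(1), of _ a "Suc n" n for n, unfolded mesh(2)]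
  have step_integral: "(step n has_integral right_riemann_sum h a t (Suc n)) {a..a + t}" for n
    using has_integral_ceiling_step[OF mesh(1)[of n], of h a "Suc n"]
    unfolding mesh(2) right_riemann_sum_def d_def[symmetric] step_def .
  then have step_integrable: "step n integrable_on {a..a + t}" for n
    by (auto simp: integrable_on_def)
  have step_bounded: "norm (step n u) \<le> C" if "u \<in> {a..a + t}" for n u
    using bounded grid(1)[OF that, of n] that by (simp add: step_def)
  have step_tendsto: "(\<lambda>n. step n u) \<longlonglongrightarrow> h u" if u_range: "u \<in> {a..a + t}" for u
    unfolding step_def
  proof (rule continuous_at_right_LIMSEQ[OF right_continuous[OF u_range]])
    have "d \<longlonglongrightarrow> 0" unfolding d_def by (rule LIMSEQ_Suc) (rule lim_const_over_n)
    then have shift_tendsto: "(\<lambda>n. u + d n) \<longlonglongrightarrow> u" by (auto intro!: tendsto_eq_intros)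
    show "(\<lambda>n. a + d n * of_int \<lceil>(u - a) / d n\<rceil>) \<longlonglongrightarrow> u"
      by (rule tendsto_sandwich[OF _ _ tendsto_const shift_tendsto]) (use grid[OF u_range] in auto)
  qed (use grid[OF u_range] in auto)
  note dominated = dominated_convergence[OF step_integrable integrable_const_ivl step_bounded
    step_tendsto]
  show "h integrable_on {a..a + t}" by (rule dominated(1))
  show "(\<lambda>n. right_riemann_sum h a t (Suc n)) \<longlonglongrightarrow> integral {a..a + t} h"
    using dominated(2) step_integral[THEN integral_unique] by simp
qed

subsection \<open>Subadditive functions\<close>

lemma subadditive_multiple:
  fixes a :: "real \<Rightarrow> real"
  assumes "\<And>s t. 0 \<le> s \<Longrightarrow> 0 \<le> t \<Longrightarrow> a (s + t) \<le> a s + a t" and "0 \<le> t" "0 \<le> r"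
  shows "a (real n * t + r) \<le> real n * a t + a r"
proof (induction n)
  case (Suc n)
  have "a (real (Suc n) * t + r) = a (t + (real n * t + r))" by (simp add: algebra_simps)
  also have "\<dots> \<le> a t + a (real n * t + r)" using assms by simp
  finally show ?case using Suc by (simp add: algebra_simps)
qed simp

lemma subadditive_ratio_le:
  fixes a :: "real \<Rightarrow> real"
  assumes subadditive: "\<And>s t. 0 \<le> s \<Longrightarrow> 0 \<le> t \<Longrightarrow> a (s + t) \<le> a s + a t"
    and p_pos: "0 < p" and t_pos: "0 < t" and a_le: "\<And>r. r \<in> {0..p} \<Longrightarrow> a r \<le> S"
  shows "a t / t \<le> a p / p + (\<bar>a p\<bar> + S) / t"
proof -
  define n where "n = nat \<lfloor>t / p\<rfloor>"
  define r where "r = t - real n * p"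
  have "real n \<le> t / p" "t / p < real n + 1" using t_pos p_pos by (simp_all add: n_def)
  then have r_bounds: "0 \<le> r" "r \<le> p" using p_pos by (auto simp: r_def field_simps)
  have "- (r * (a p / p)) \<le> r / p * \<bar>a p\<bar>"
    using r_bounds p_pos abs_ge_minus_self[of "r * (a p / p)"] by (simp add: abs_mult)
  also have "\<dots> \<le> 1 * \<bar>a p\<bar>" using r_bounds p_pos by (intro mult_right_mono) auto
  finally have "real n * a p \<le> t * (a p / p) + \<bar>a p\<bar>"
    using p_pos by (simp add: r_def field_simps)
  moreover have "a t \<le> real n * a p + a r"
    using subadditive_multiple[of a p r n, OF subadditive] p_pos r_bounds by (simp add: r_def)
  ultimately have "a t \<le> t * (a p / p) + (\<bar>a p\<bar> + S)" using a_le[of r] r_bounds by simp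
  then show ?thesis using t_pos by (simp add: field_simps)
qed

lemma subadditive_tendsto_INF:
  fixes a :: "real \<Rightarrow> real"
  assumes subadditive: "\<And>s t. 0 \<le> s \<Longrightarrow> 0 \<le> t \<Longrightarrow> a (s + t) \<le> a s + a t"
    and above: "\<And>t. bdd_above (a ` {0..t})"
    and below: "bdd_below ((\<lambda>t. a t / t) ` {0<..})"
  shows "((\<lambda>t. a t / t) \<longlongrightarrow> (INF t\<in>{0<..}. a t / t)) at_top"
proof (rule order_tendstoI)
  fix l assume l_less: "l < (INF t\<in>{0<..}. a t / t)"
  show "\<forall>\<^sub>F t in at_top. l < a t / t"
    using eventually_gt_at_top[of 0]
    by eventually_elim (use l_less cINF_lower[OF below] in force)
next
  fix u assume "(INF t\<in>{0<..}. a t / t) < u"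
  then obtain p where p_witness: "0 < p" "a p / p < u"
    using cINF_less_iff[OF _ below, of u] by auto
  obtain S where S_bound: "\<And>r. r \<in> {0..p} \<Longrightarrow> a r \<le> S"
    using above[of p] unfolding bdd_above_def by blast
  have "((\<lambda>t. a p / p + (\<bar>a p\<bar> + S) / t) \<longlongrightarrow> a p / p + 0) at_top"
    by (intro tendsto_intros real_tendsto_divide_at_top[OF tendsto_const] filterlim_ident)
  then have "\<forall>\<^sub>F t in at_top. a p / p + (\<bar>a p\<bar> + S) / t < u"
    using p_witness by (auto dest: order_tendstoD)
  then show "\<forall>\<^sub>F t in at_top. a t / t < u"
    using eventually_gt_at_top[of 0]
    by eventually_elim (use subadditive_ratio_le[OF subadditive p_witness(1) _ S_bound] in force)
qed

subsection \<open>Equicontinuous families\<close>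

definition equicontinuous ::
  "'i set \<Rightarrow> ('i \<Rightarrow> 'a::topological_space \<Rightarrow> 'b::metric_space) \<Rightarrow> bool" where
  "equicontinuous I v \<longleftrightarrow>
    (\<forall>x. \<forall>\<epsilon>>0. \<forall>\<^sub>F y in nhds x. \<forall>i\<in>I. dist (v i y) (v i x) < \<epsilon>)"

lemma equicontinuousD:
  assumes "equicontinuous I v" "0 < \<epsilon>"
  shows "\<forall>\<^sub>F y in nhds x. \<forall>i\<in>I. dist (v i y) (v i x) < \<epsilon>"
  using assms by (simp add: equicontinuous_def)

lemma equicontinuous_reindex:
  assumes "equicontinuous J v" "r ` I \<subseteq> J"
  shows "equicontinuous I (\<lambda>i. v (r i))"
  unfolding equicontinuous_def
proof (intro allI impI)
  fix x and \<epsilon> :: real assume "0 < \<epsilon>"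
  then show "\<forall>\<^sub>F y in nhds x. \<forall>i\<in>I. dist (v (r i) y) (v (r i) x) < \<epsilon>"
    by (rule eventually_mono[OF equicontinuousD[OF assms(1)]]) (use assms(2) in auto)
qed

lemma equicontinuous_imp_continuous_on:
  assumes "equicontinuous I v" "i \<in> I"
  shows "continuous_on S (v i)"
proof -
  have "\<forall>\<^sub>F y in at x within S. dist (v i y) (v i x) < \<epsilon>" if "0 < \<epsilon>" for x \<epsilon>
    by (rule filter_leD[OF at_within_le_nhds],
      rule eventually_mono[OF equicontinuousD[OF assms(1) that]])
      (use assms(2) in auto)
  then show ?thesis by (auto simp: continuous_on_def tendsto_iff)
qed

lemma equicontinuous_uniformly_continuous_compose:
  assumes "equicontinuous I v" "uniformly_continuous_on S h" "\<And>i x. i \<in> I \<Longrightarrow> v i x \<in> S"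
  shows "equicontinuous I (\<lambda>i x. h (v i x))"
  unfolding equicontinuous_def
proof (intro allI impI)
  fix x and \<epsilon> :: real assume "0 < \<epsilon>"
  with assms(2) obtain \<eta> where modulus: "0 < \<eta>"
    "\<And>p q. p \<in> S \<Longrightarrow> q \<in> S \<Longrightarrow> dist p q < \<eta> \<Longrightarrow> dist (h p) (h q) < \<epsilon>"
    unfolding uniformly_continuous_on_def by metis
  from equicontinuousD[OF assms(1) modulus(1)]
  show "\<forall>\<^sub>F y in nhds x. \<forall>i\<in>I. dist (h (v i y)) (h (v i x)) < \<epsilon>"
    by (rule eventually_mono) (use modulus(2) assms(3) in blast)
qed

lemma equicontinuous_max:
  fixes v w :: "'i \<Rightarrow> 'a::topological_space \<Rightarrow> real"
  assumes "equicontinuous I v" "equicontinuous I w"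
  shows "equicontinuous I (\<lambda>i x. max (v i x) (w i x))"
  unfolding equicontinuous_def
proof (intro allI impI)
  fix x and \<epsilon> :: real assume "0 < \<epsilon>"
  from equicontinuousD[OF assms(1) this] equicontinuousD[OF assms(2) this]
  show "\<forall>\<^sub>F y in nhds x. \<forall>i\<in>I. dist (max (v i y) (w i y)) (max (v i x) (w i x)) < \<epsilon>"
  proof eventually_elim
    case (elim y)
    show ?case
    proof
      fix i assume "i \<in> I"
      with elim have "\<bar>v i y - v i x\<bar> < \<epsilon>" "\<bar>w i y - w i x\<bar> < \<epsilon>" by (auto simp: dist_real_def)
      then show "dist (max (v i y) (w i y)) (max (v i x) (w i x)) < \<epsilon>"
        unfolding dist_real_def by linarith
    qed
  qed
qed

lemma equicontinuous_uniform_approximation: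
  assumes approx: "\<And>\<epsilon>::real. 0 < \<epsilon> \<Longrightarrow>
    \<exists>w. equicontinuous I w \<and> (\<forall>i\<in>I. \<forall>x. dist (v i x) (w i x) < \<epsilon>)"
  shows "equicontinuous I v"
  unfolding equicontinuous_def
proof (intro allI impI)
  fix x and \<epsilon> :: real assume "0 < \<epsilon>"
  then have third_pos: "0 < \<epsilon> / 3" by simp
  from approx[OF third_pos] obtain w where w_approx: "equicontinuous I w"
    "\<And>i x. i \<in> I \<Longrightarrow> dist (v i x) (w i x) < \<epsilon> / 3" by blast
  from equicontinuousD[OF w_approx(1) third_pos, of x]
  show "\<forall>\<^sub>F y in nhds x. \<forall>i\<in>I. dist (v i y) (v i x) < \<epsilon>"
  proof eventually_elim
    case (elim y)
    show ?case
    proof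
      fix i assume "i \<in> I"
      with elim have "dist (w i y) (w i x) < \<epsilon> / 3" by blast
      with w_approx(2)[OF \<open>i \<in> I\<close>, of x] w_approx(2)[OF \<open>i \<in> I\<close>, of y]
      have "dist (v i y) (w i y) + dist (w i y) (w i x) + dist (v i x) (w i x) < \<epsilon>" by linarith
      then show "dist (v i y) (v i x) < \<epsilon>" by metric
    qed
  qed
qed

lemma equicontinuous_adjoin_limit:
  assumes "equicontinuous UNIV v" "\<And>x. (\<lambda>n::nat. v n x) \<longlonglongrightarrow> g x"
  shows "equicontinuous UNIV (case_option g v)"
  unfolding equicontinuous_def
proof (intro allI impI)
  fix x and \<epsilon> :: real assume \<epsilon>_pos: "0 < \<epsilon>"
  then have "0 < \<epsilon> / 2" by simp
  from equicontinuousD[OF assms(1) this, of x]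
  show "\<forall>\<^sub>F y in nhds x. \<forall>i\<in>UNIV. dist (case_option g v i y) (case_option g v i x) < \<epsilon>"
  proof eventually_elim
    case (elim y)
    have "dist (g y) (g x) \<le> \<epsilon> / 2"
      by (rule LIMSEQ_le_const2[OF tendsto_dist[OF assms(2) assms(2)]])
        (use elim in \<open>auto intro!: less_imp_le\<close>)
    then have "dist (g y) (g x) < \<epsilon>" "dist (v n y) (v n x) < \<epsilon>" for n
      using elim[THEN bspec, of n] \<epsilon>_pos by auto
    then show ?case by (simp split: option.split)
  qed
qed

lemma equicontinuous_pointwise_imp_uniform_limit:
  assumes equicontinuous: "equicontinuous UNIV v" and pointwise: "\<And>x. (\<lambda>n::nat. v n x) \<longlonglongrightarrow> g x"
    and K_compact: "compact K"
  shows "uniform_limit K v g sequentially"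
proof (rule uniform_limitI)
  fix \<epsilon> :: real assume "0 < \<epsilon>"
  then have third_pos: "0 < \<epsilon> / 3" by simp
  have "\<exists>S. open S \<and> x \<in> S \<and> (\<forall>y\<in>S. \<forall>i. dist (case_option g v i y) (case_option g v i x) < \<epsilon> / 3)"
    for x
    using equicontinuousD[OF equicontinuous_adjoin_limit[OF equicontinuous pointwise] third_pos,
      of x]
    unfolding eventually_nhds by auto
  then obtain S where neighbourhood: "\<And>x. open (S x)" "\<And>x. x \<in> S x"
      "\<And>x y i. y \<in> S x \<Longrightarrow> dist (case_option g v i y) (case_option g v i x) < \<epsilon> / 3" by metis
  obtain D where finite_cover: "D \<subseteq> K" "finite D" "K \<subseteq> (\<Union>x\<in>D. S x)"
    by (rule compactE_image[OF K_compact, of K S]) (use neighbourhood in auto)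
  have "\<forall>\<^sub>F n in sequentially. \<forall>x\<in>D. dist (v n x) (g x) < \<epsilon> / 3"
    by (intro eventually_ball_finite[OF finite_cover(2)] ballI tendstoD[OF pointwise third_pos])
  then show "\<forall>\<^sub>F n in sequentially. \<forall>x\<in>K. dist (v n x) (g x) < \<epsilon>"
  proof eventually_elim
    case (elim n)
    show ?case
    proof
      fix y assume "y \<in> K"
      then obtain x where centre: "x \<in> D" "y \<in> S x" using finite_cover by auto
      have "dist (v n y) (g y) \<le> dist (v n y) (v n x) + dist (v n x) (g x) + dist (g y) (g x)"
        by metric
      then show "dist (v n y) (g y) < \<epsilon>"
        using neighbourhood(3)[OF centre(2), of "Some n"] neighbourhood(3)[OF centre(2), of None]
          elim centre(1) by fastforce
    qed
  qed
qed

lemma equicontinuous_convergent_dense: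
  fixes v :: "nat \<Rightarrow> 'a::topological_space \<Rightarrow> 'b::complete_space"
  assumes equicontinuous: "equicontinuous UNIV v"
    and dense: "\<And>S. open S \<Longrightarrow> S \<noteq> {} \<Longrightarrow> \<exists>y\<in>D. y \<in> S"
    and convergent_D: "\<And>y. y \<in> D \<Longrightarrow> convergent (\<lambda>n. v n y)"
  shows "convergent (\<lambda>n. v n x)"
proof (rule Cauchy_convergent, rule metric_CauchyI)
  fix \<epsilon> :: real assume "0 < \<epsilon>"
  then have third_pos: "0 < \<epsilon> / 3" by simp
  obtain S where "open S" "x \<in> S" and near_x: "\<And>y n. y \<in> S \<Longrightarrow> dist (v n y) (v n x) < \<epsilon> / 3"
    using equicontinuousD[OF equicontinuous third_pos, of x] unfolding eventually_nhds by blast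
  then obtain y where y_near_x: "y \<in> D" "y \<in> S" using dense[of S] by auto
  obtain N where Cauchy_y: "\<And>m n. N \<le> m \<Longrightarrow> N \<le> n \<Longrightarrow> dist (v m y) (v n y) < \<epsilon> / 3"
    using metric_CauchyD[OF convergent_Cauchy[OF convergent_D[OF y_near_x(1)]] third_pos] by blast
  have "dist (v m x) (v n x) < \<epsilon>" if "N \<le> m" "N \<le> n" for m n
  proof -
    have "dist (v m x) (v n x) \<le> dist (v m y) (v m x) + dist (v m y) (v n y) + dist (v n y) (v n x)"
      by metric
    then show ?thesis
      using Cauchy_y[OF that] near_x[OF y_near_x(2), of m] near_x[OF y_near_x(2), of n] by linarith
  qed
  then show "\<exists>N. \<forall>m\<ge>N. \<forall>n\<ge>N. dist (v m x) (v n x) < \<epsilon>" by blast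
qed

theorem Arzela_Ascoli_locally_uniform:
  fixes v :: "nat \<Rightarrow> 'a::second_countable_topology \<Rightarrow> 'b::{banach, heine_borel}"
  assumes "equicontinuous UNIV v" and bounded: "\<And>n x. norm (v n x) \<le> C"
  obtains r g where "strict_mono (r :: nat \<Rightarrow> nat)" "continuous_on UNIV g"
    "\<And>x. (\<lambda>n. v (r n) x) \<longlonglongrightarrow> g x"
    "\<And>K. compact K \<Longrightarrow> uniform_limit K (\<lambda>n. v (r n)) g sequentially"
proof -
  obtain D :: "'a set" where D_dense: "countable D" "\<And>S. open S \<Longrightarrow> S \<noteq> {} \<Longrightarrow> \<exists>y\<in>D. y \<in> S"
    using countable_dense_setE by auto
  obtain r where r_mono: "strict_mono (r :: nat \<Rightarrow> nat)"
    and convergent_D: "\<And>y. y \<in> D \<Longrightarrow> convergent (\<lambda>n. v (r n) y)"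
    using function_convergent_subsequence[OF D_dense(1), of v C] bounded unfolding convergent_def
    by metis
  have equicontinuous: "equicontinuous UNIV (\<lambda>n. v (r n))"
    by (rule equicontinuous_reindex[OF assms(1)]) simp
  define g where "g x = lim (\<lambda>n. v (r n) x)" for x
  have pointwise: "(\<lambda>n. v (r n) x) \<longlonglongrightarrow> g x" for x
    using equicontinuous_convergent_dense[OF equicontinuous D_dense(2) convergent_D]
    by (simp add: g_def convergent_LIMSEQ_iff)
  note with_limit = equicontinuous_adjoin_limit[OF equicontinuous pointwise]
  have "continuous_on UNIV g"
    using equicontinuous_imp_continuous_on[OF with_limit, of None] by simp
  then show ?thesis
    using equicontinuous_pointwise_imp_uniform_limit[OF equicontinuous pointwise]
    by (intro that[OF r_mono _ pointwise])
qed

subsection \<open>Integrals and total variation\<close>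

lemma finite_measure_restrict_lborel:
  fixes a b :: real
  shows "finite_measure (restrict_space lborel {a..b})"
  by (rule finite_measureI)
    (simp add: emeasure_restrict_space space_restrict_space emeasure_lborel_Icc_eq)

lemma (in prob_space) integral_eq_integral_tail:
  fixes \<phi> :: "'a \<Rightarrow> real"
  assumes [measurable]: "\<phi> \<in> borel_measurable M" and \<phi>_range: "\<And>z. z \<in> space M \<Longrightarrow> \<phi> z \<in> {a..b}"
  shows "(\<integral>z. \<phi> z \<partial>M) = a + (\<integral>u. prob {z \<in> space M. u < \<phi> z} \<partial>restrict_space lborel {a..b})"
proof -
  define L where "L = restrict_space lborel {a..b}"
  have [measurable]: "(\<lambda>u. u) \<in> borel_measurable L"
    unfolding L_def by (rule measurable_restrict_space1) simp
  interpret L: finite_measure L unfolding L_def by (rule finite_measure_restrict_lborel)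
  interpret pair_sigma_finite M L ..
  have measure_slice: "measure L ({..<\<phi> z} \<inter> space L) = \<phi> z - a" if "z \<in> space M" for z
  proof -
    have "{..<\<phi> z} \<inter> space L = {a..<\<phi> z}"
      using \<phi>_range[OF that] by (auto simp: L_def space_restrict_space)
    moreover have "measure L {a..<\<phi> z} = measure lborel {a..<\<phi> z}"
      unfolding L_def using \<phi>_range[OF that] by (intro measure_restrict_space) auto
    ultimately show ?thesis using \<phi>_range[OF that] by simp
  qed
  interpret product: finite_measure "M \<Otimes>\<^sub>M L"
    by (intro finite_measure_pair_measure) unfold_locales
  have "integrable (M \<Otimes>\<^sub>M L) (\<lambda>(z, u). indicator {..<\<phi> z} u :: real)"
    by (rule product.integrable_const_bound[of _ 1]) (auto simp: indicator_def)
  then have "(\<integral>z. (\<integral>u. indicator {..<\<phi> z} u \<partial>L) \<partial>M)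
      = (\<integral>u. (\<integral>z. indicator {..<\<phi> z} u \<partial>M) \<partial>L :: real)"
    by (rule Fubini_integral[symmetric])
  also have "\<dots> = (\<integral>u. (\<integral>z. indicator {z \<in> space M. u < \<phi> z} z \<partial>M) \<partial>L)"
    by (intro Bochner_Integration.integral_cong) (auto simp: indicator_def)
  also have "\<dots> = (\<integral>u. prob {z \<in> space M. u < \<phi> z} \<partial>L)" by simp
  finally have "(\<integral>u. prob {z \<in> space M. u < \<phi> z} \<partial>L) = (\<integral>z. (\<integral>u. indicator {..<\<phi> z} u \<partial>L) \<partial>M)" ..
  also have "\<dots> = (\<integral>z. \<phi> z - a \<partial>M)"
    by (intro Bochner_Integration.integral_cong) (simp_all add: measure_slice)
  also have "\<dots> = (\<integral>z. \<phi> z \<partial>M) - a"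
  proof -
    have "integrable M \<phi>"
      by (rule integrable_const_bound[of _ "max \<bar>a\<bar> \<bar>b\<bar>"])
        (use \<phi>_range in \<open>fastforce intro!: AE_I2\<close>)+
    then show ?thesis by (simp add: prob_space)
  qed
  finally show ?thesis by (simp add: L_def)
qed

lemma (in prob_space) integrable_tail:
  fixes \<phi> :: "'a \<Rightarrow> real" and a b :: real
  assumes "\<phi> \<in> borel_measurable M"
  shows "integrable (restrict_space lborel {a..b}) (\<lambda>u. prob {z \<in> space M. u < \<phi> z})"
proof -
  interpret L: finite_measure "restrict_space lborel {a..b}"
    by (rule finite_measure_restrict_lborel)
  have "mono (\<lambda>u. - prob {z \<in> space M. u < \<phi> z})"
    using assms by (intro monoI) (auto intro: finite_measure_mono)
  then have "(\<lambda>u. - (- prob {z \<in> space M. u < \<phi> z})) \<in> borel_measurable borel"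
    by (intro borel_measurable_uminus borel_measurable_mono)
  then have "(\<lambda>u. prob {z \<in> space M. u < \<phi> z}) \<in> borel_measurable (restrict_space lborel {a..b})"
    by (auto intro: measurable_restrict_space1)
  then show ?thesis by (rule L.integrable_const_bound[of _ 1, rotated]) simp
qed

lemma abs_integral_diff_le_variation:
  fixes \<phi> :: "'a \<Rightarrow> real"
  assumes M_prob: "prob_space M" and N_prob: "prob_space N" and sets_eq: "sets N = sets M"
    and \<phi>_measurable: "\<phi> \<in> borel_measurable M" and \<phi>_range: "\<And>z. z \<in> space M \<Longrightarrow> \<phi> z \<in> {a..b}"
    and a_le_b: "a \<le> b"
    and variation: "\<And>A. A \<in> sets M \<Longrightarrow> \<bar>measure M A - measure N A\<bar> \<le> V"
  shows "\<bar>(\<integral>z. \<phi> z \<partial>M) - (\<integral>z. \<phi> z \<partial>N)\<bar> \<le> (b - a) * V"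
proof -
  interpret M: prob_space M by (rule M_prob)
  interpret N: prob_space N by (rule N_prob)
  define L where "L = restrict_space lborel {a..b}"
  interpret L: finite_measure L unfolding L_def by (rule finite_measure_restrict_lborel)
  have space_eq: "space N = space M" using sets_eq by (rule sets_eq_imp_space_eq)
  have \<phi>_measurable_N: "\<phi> \<in> borel_measurable N"
    using \<phi>_measurable by (simp add: measurable_cong_sets[OF sets_eq refl])
  define tail where "tail \<mu> u = measure \<mu> {z \<in> space M. u < \<phi> z}" for \<mu> u
  have tail_integrable: "integrable L (tail M)" "integrable L (tail N)"
    using M.integrable_tail[OF \<phi>_measurable, of a b] N.integrable_tail[OF \<phi>_measurable_N, of a b]
    by (simp_all add: tail_def[abs_def] L_def space_eq)
  have "(\<integral>z. \<phi> z \<partial>M) - (\<integral>z. \<phi> z \<partial>N) = (\<integral>u. tail M u \<partial>L) - (\<integral>u. tail N u \<partial>L)"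
    using M.integral_eq_integral_tail[OF \<phi>_measurable \<phi>_range]
      N.integral_eq_integral_tail[OF \<phi>_measurable_N, of a b] \<phi>_range
    by (simp add: tail_def L_def space_eq)
  also have "\<dots> = (\<integral>u. tail M u - tail N u \<partial>L)"
    using tail_integrable by (rule Bochner_Integration.integral_diff[symmetric])
  finally have "\<bar>(\<integral>z. \<phi> z \<partial>M) - (\<integral>z. \<phi> z \<partial>N)\<bar> \<le> (\<integral>u. \<bar>tail M u - tail N u\<bar> \<partial>L)"
    using integral_norm_bound[of L "\<lambda>u. tail M u - tail N u"] by simp
  also have "\<dots> \<le> (\<integral>u. V \<partial>L)"
  proof (rule integral_mono)
    show "\<bar>tail M u - tail N u\<bar> \<le> V" for u
      unfolding tail_def using \<phi>_measurable by (intro variation) simp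
  qed (use tail_integrable in simp_all)
  also have "\<dots> = (b - a) * V"
    using a_le_b by (simp add: L_def measure_restrict_space space_restrict_space)
  finally show ?thesis .
qed

subsection \<open>Transition operators\<close>

definition bounded_borel :: "real \<Rightarrow> ('a::topological_space \<Rightarrow> real) set" where
  "bounded_borel C = {\<phi> \<in> borel_measurable borel. \<forall>x. \<bar>\<phi> x\<bar> \<le> C}"

lemma bounded_borelD:
  assumes "\<phi> \<in> bounded_borel C"
  shows "\<phi> \<in> borel_measurable borel" "\<bar>\<phi> x\<bar> \<le> C" "0 \<le> C"
  using assms by (auto simp: bounded_borel_def intro: order_trans[OF abs_ge_zero])

lemma exp_bounded_borel:
  assumes "w \<in> bounded_borel C"
  shows "(\<lambda>z. exp (w z)) \<in> bounded_borel (exp C)"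
  using assms by (auto simp: bounded_borel_def abs_le_iff[of "w _"])

locale ultra_feller_process =
  fixes M :: "'w measure" and Px :: "'a::{metric_space, second_countable_topology} \<Rightarrow> 'w measure"
    and X :: "real \<Rightarrow> 'w \<Rightarrow> 'a"
  assumes process: "standard_Feller_Markov M Px X"
    and continuous_transitions: "A2 Px X"
begin

lemma prob_space_Px: "prob_space (Px x)"
  and sets_Px [simp, measurable_cong]: "sets (Px x) = sets M"
  and X_measurable: "0 \<le> t \<Longrightarrow> X t \<in> measurable M borel"
  and AE_X_0: "AE \<omega> in Px x. X 0 \<omega> = x"
  and X_right_continuous: "\<omega> \<in> space M \<Longrightarrow> 0 \<le> t \<Longrightarrow> continuous (at_right t) (\<lambda>s. X s \<omega>)"
  using process unfolding standard_Feller_Markov_def by auto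

lemma space_Px [simp]: "space (Px x) = space M"
  using sets_Px by (rule sets_eq_imp_space_eq)

lemma measurable_Px [simp]: "measurable (Px x) K = measurable M K"
  by (rule measurable_cong_sets) simp_all

sublocale Px: prob_space "Px x" for x
  by (rule prob_space_Px)

lemma prob_space_M [simp]: "measure (Px x) (space M) = 1"
  using Px.prob_space by simp

abbreviation past :: "real \<Rightarrow> 'w measure" where
  "past t \<equiv> natfilt M X t"

lemma space_past [simp]: "space (past t) = space M"
  by (simp add: natfilt_def space_measure_of_conv)

lemma sets_past: "sets (past t) =
    sigma_sets (space M) {X s -` A \<inter> space M | s A. s \<in> {0..t} \<and> A \<in> sets borel}"
  unfolding natfilt_def by (rule sets_measure_of) auto

lemma X_past_measurable: "0 \<le> s \<Longrightarrow> s \<le> t \<Longrightarrow> X s \<in> measurable (past t) borel"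
  by (rule measurableI) (auto simp: sets_past intro!: sigma_sets.Basic)

lemma past_subset: "sets (past t) \<subseteq> sets M"
  unfolding sets_past using X_measurable
  by (intro sets.sigma_sets_subset) (auto intro: measurable_sets)

lemma past_mono: "s \<le> t \<Longrightarrow> sets (past s) \<subseteq> sets (past t)"
  unfolding sets_past by (intro sigma_sets_mono') fastforce

lemma measurable_past: "g \<in> measurable (past t) K \<Longrightarrow> g \<in> measurable M K"
  by (rule measurable_from_subalg[of M "past t"]) (auto simp: subalgebra_def past_subset)

lemma measurable_past_mono: "s \<le> t \<Longrightarrow> g \<in> measurable (past s) K \<Longrightarrow> g \<in> measurable (past t) K"
  by (rule measurable_from_subalg[of "past t" "past s"]) (auto simp: subalgebra_def past_mono)

lemma integrable_bounded:
  fixes g :: "'w \<Rightarrow> real"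
  assumes "g \<in> borel_measurable M" "\<And>\<omega>. \<omega> \<in> space M \<Longrightarrow> \<bar>g \<omega>\<bar> \<le> K"
  shows "integrable (Px x) g"
  using assms by (intro Px.integrable_const_bound[of _ K] AE_I2) auto

lemma abs_integral_le:
  fixes g :: "'w \<Rightarrow> real"
  assumes "g \<in> borel_measurable M" "\<And>\<omega>. \<omega> \<in> space M \<Longrightarrow> \<bar>g \<omega>\<bar> \<le> K"
  shows "\<bar>\<integral>\<omega>. g \<omega> \<partial>Px x\<bar> \<le> K"
proof -
  have "\<bar>\<integral>\<omega>. g \<omega> \<partial>Px x\<bar> \<le> (\<integral>\<omega>. \<bar>g \<omega>\<bar> \<partial>Px x)"
    using integral_norm_bound[of "Px x" g] by simp
  also have "\<dots> \<le> K"
    using integrable_bounded[OF assms] assms(2) by (intro Px.integral_le_const) auto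
  finally show ?thesis .
qed

lemma bounded_convergence:
  fixes g :: "nat \<Rightarrow> 'w \<Rightarrow> real"
  assumes "\<And>n. g n \<in> borel_measurable M" "\<And>n \<omega>. \<omega> \<in> space M \<Longrightarrow> \<bar>g n \<omega>\<bar> \<le> K"
    and "\<And>\<omega>. \<omega> \<in> space M \<Longrightarrow> (\<lambda>n. g n \<omega>) \<longlonglongrightarrow> h \<omega>"
  shows "(\<lambda>n. \<integral>\<omega>. g n \<omega> \<partial>Px x) \<longlonglongrightarrow> (\<integral>\<omega>. h \<omega> \<partial>Px x)"
proof (rule integral_dominated_convergence[where w = "\<lambda>_. K"])
  show "h \<in> borel_measurable (Px x)"
    unfolding measurable_Px by (rule borel_measurable_LIMSEQ_real[OF assms(3,1)])
qed (use assms in \<open>auto intro!: AE_I2\<close>)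

definition transition_kernel :: "real \<Rightarrow> 'a \<Rightarrow> 'a measure" where
  "transition_kernel t y = distr (Px y) borel (X t)"

lemma prob_space_transition_kernel: "0 \<le> t \<Longrightarrow> prob_space (transition_kernel t y)"
  unfolding transition_kernel_def by (intro Px.prob_space_distr) (simp add: X_measurable)

lemma sets_transition_kernel [simp]: "sets (transition_kernel t y) = sets borel"
  by (simp add: transition_kernel_def)

lemma space_transition_kernel [simp]: "space (transition_kernel t y) = UNIV"
  by (simp add: transition_kernel_def)

lemma measure_transition_kernel:
  assumes "0 \<le> t" "A \<in> sets borel"
  shows "measure (transition_kernel t y) A = Ptrans Px X t y A"
proof -
  have "X t -` A \<inter> space M = {\<omega> \<in> space M. X t \<omega> \<in> A}" by auto
  then show ?thesis
    using assms by (simp add: transition_kernel_def measure_distr Ptrans_def X_measurable)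
qed

definition P :: "real \<Rightarrow> ('a \<Rightarrow> real) \<Rightarrow> 'a \<Rightarrow> real" where
  "P t \<phi> y = (\<integral>\<omega>. \<phi> (X t \<omega>) \<partial>Px y)"

lemma integral_transition_kernel:
  assumes "0 \<le> t" "\<phi> \<in> borel_measurable borel"
  shows "(\<integral>z. \<phi> z \<partial>transition_kernel t y) = P t \<phi> y"
  unfolding transition_kernel_def P_def using assms
  by (intro integral_distr) (simp_all add: X_measurable)

lemma P_0:
  assumes "\<phi> \<in> borel_measurable borel"
  shows "P 0 \<phi> y = \<phi> y"
proof -
  note [measurable] = X_measurable[OF order_refl] assms
  have "P 0 \<phi> y = (\<integral>\<omega>. \<phi> y \<partial>Px y)"
    unfolding P_def using AE_X_0[of y] by (intro integral_cong_AE) auto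
  then show ?thesis by simp
qed

lemma Ptrans_eq_P:
  assumes "0 \<le> t" "A \<in> sets borel"
  shows "Ptrans Px X t y A = P t (indicator A) y"
  using assms integral_transition_kernel[of t "indicator A" y] measure_transition_kernel[of t A y]
  by simp

definition transition_variation :: "real \<Rightarrow> 'a \<Rightarrow> 'a \<Rightarrow> real" where
  "transition_variation t x y = (SUP A\<in>sets borel. \<bar>Ptrans Px X t y A - Ptrans Px X t x A\<bar>)"

lemma Ptrans_diff_le_variation:
  assumes "A \<in> sets borel"
  shows "\<bar>Ptrans Px X t y A - Ptrans Px X t x A\<bar> \<le> transition_variation t x y"
  unfolding transition_variation_def
proof (rule cSUP_upper[OF assms])
  have "\<bar>p - q\<bar> \<le> 1" if "p \<in> {0..1}" "q \<in> {0..1}" for p q :: real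
    using that by auto
  then have "\<bar>Ptrans Px X t y A - Ptrans Px X t x A\<bar> \<le> 1" for A
    unfolding Ptrans_def by (meson atLeastAtMost_iff measure_nonneg Px.prob_le_1)
  then show "bdd_above ((\<lambda>A. \<bar>Ptrans Px X t y A - Ptrans Px X t x A\<bar>) ` sets borel)"
    by (intro bdd_aboveI2)
qed

lemma transition_variation_tendsto:
  assumes "0 < t"
  shows "(transition_variation t x \<longlongrightarrow> 0) (nhds x)"
proof -
  have variation_self: "transition_variation t x x = 0"
  proof -
    have "sets (borel :: 'a measure) \<noteq> {}" using sets.empty_sets by blast
    then show ?thesis by (simp add: transition_variation_def)
  qed
  have "(\<lambda>n. transition_variation t x (u n)) \<longlonglongrightarrow> 0" if "u \<longlonglongrightarrow> x" for u
    unfolding transition_variation_def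
    using continuous_transitions[unfolded A2_def, rule_format, OF assms that] .
  then have "isCont (transition_variation t x) x"
    by (simp add: continuous_at_sequentially comp_def variation_self)
  then show ?thesis
    using tendsto_at_iff_tendsto_nhds[of "transition_variation t x" x]
    by (simp add: isCont_def variation_self)
qed

lemma Ptrans_measurable:
  assumes t_nonneg: "0 \<le> t" and A_borel: "A \<in> sets borel"
  shows "(\<lambda>y. Ptrans Px X t y A) \<in> borel_measurable borel"
proof (cases "t = 0")
  case True
  then show ?thesis using A_borel by (simp add: Ptrans_eq_P P_0)
next
  case False
  have "isCont (\<lambda>y. Ptrans Px X t y A) x" for x
    unfolding isCont_def
  proof (rule Lim_null_comparison[THEN LIM_zero_cancel])
    show "(transition_variation t x \<longlongrightarrow> 0) (at x)"
      by (rule tendsto_mono[OF at_within_le_nhds transition_variation_tendsto])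
        (use t_nonneg False in simp)
  qed (simp add: Ptrans_diff_le_variation[OF A_borel])
  then show ?thesis
    by (intro borel_measurable_continuous_onI) (simp add: continuous_on_eq_continuous_at)
qed

lemma transition_kernel_measurable:
  assumes "0 \<le> t"
  shows "transition_kernel t \<in> measurable borel (subprob_algebra borel)"
proof (rule measurable_subprob_algebra)
  fix A :: "'a set" assume A_borel: "A \<in> sets borel"
  have "emeasure (transition_kernel t y) A = ennreal (Ptrans Px X t y A)" for y
    using prob_space_transition_kernel[OF assms, of y]
    by (simp add: prob_space_def finite_measure.emeasure_eq_measure
      measure_transition_kernel[OF assms A_borel])
  then show "(\<lambda>y. emeasure (transition_kernel t y) A) \<in> borel_measurable borel"
    using Ptrans_measurable[OF assms A_borel] by simp
qed (simp_all add: prob_space_transition_kernel[OF assms] prob_space_imp_subprob_space)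

lemma P_bounded_borel:
  assumes "0 \<le> t" "\<phi> \<in> bounded_borel C"
  shows "P t \<phi> \<in> bounded_borel C"
proof -
  note [measurable] = X_measurable[OF assms(1)] bounded_borelD(1)[OF assms(2)]
  have "(\<lambda>y. \<integral>z. \<phi> z \<partial>transition_kernel t y) \<in> borel_measurable borel"
    using transition_kernel_measurable[OF assms(1)] by measurable
  moreover have "\<bar>P t \<phi> y\<bar> \<le> C" for y
    unfolding P_def using bounded_borelD(2)[OF assms(2)] by (intro abs_integral_le) auto
  ultimately show ?thesis by (simp add: bounded_borel_def integral_transition_kernel[OF assms(1)])
qed

lemma P_diff_le_variation:
  assumes t_nonneg: "0 \<le> t" and \<phi>_bounded: "\<phi> \<in> bounded_borel C"
  shows "\<bar>P t \<phi> y - P t \<phi> x\<bar> \<le> 2 * C * transition_variation t x y"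
proof -
  note \<phi>_borel = bounded_borelD(1)[OF \<phi>_bounded]
  have "\<phi> z \<in> {- C..C}" for z using bounded_borelD(2)[OF \<phi>_bounded, of z] by (auto simp: abs_le_iff)
  then have "\<bar>(\<integral>z. \<phi> z \<partial>transition_kernel t y) - (\<integral>z. \<phi> z \<partial>transition_kernel t x)\<bar>
      \<le> (C - - C) * transition_variation t x y"
    using \<phi>_borel bounded_borelD(3)[OF \<phi>_bounded] t_nonneg
    by (intro abs_integral_diff_le_variation prob_space_transition_kernel)
      (simp_all add: measure_transition_kernel Ptrans_diff_le_variation cong: measurable_cong_sets)
  then show ?thesis by (simp add: integral_transition_kernel[OF t_nonneg \<phi>_borel])
qed

lemma P_equicontinuous:
  assumes "0 < t"
  shows "equicontinuous (bounded_borel C) (P t)"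
  unfolding equicontinuous_def
proof (intro allI impI)
  fix x and \<epsilon> :: real assume "0 < \<epsilon>"
  moreover have "((\<lambda>y. 2 * C * transition_variation t x y) \<longlongrightarrow> 2 * C * 0) (nhds x)"
    by (intro tendsto_intros transition_variation_tendsto assms)
  ultimately have "\<forall>\<^sub>F y in nhds x. 2 * C * transition_variation t x y < \<epsilon>"
    by (auto dest: order_tendstoD)
  then show "\<forall>\<^sub>F y in nhds x. \<forall>\<phi>\<in>bounded_borel C. dist (P t \<phi> y) (P t \<phi> x) < \<epsilon>"
  proof eventually_elim
    case (elim y)
    show ?case
    proof
      fix \<phi> :: "'a \<Rightarrow> real" assume "\<phi> \<in> bounded_borel C"
      from P_diff_le_variation[OF less_imp_le[OF assms] this, of y x] elim
      show "dist (P t \<phi> y) (P t \<phi> x) < \<epsilon>" by (simp add: dist_real_def)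
    qed
  qed
qed

definition restricted :: "'a \<Rightarrow> 'w set \<Rightarrow> 'w measure" where
  "restricted x G = density (Px x) (indicator G)"

lemma sets_restricted [simp, measurable_cong]: "sets (restricted x G) = sets M"
  and space_restricted [simp]: "space (restricted x G) = space M"
  by (simp_all add: restricted_def)

lemma subprob_space_restricted:
  assumes "G \<in> sets M"
  shows "subprob_space (restricted x G)"
proof (rule subprob_spaceI)
  show "emeasure (restricted x G) (space (restricted x G)) \<le> 1"
    using assms by (simp add: restricted_def emeasure_restricted Px.emeasure_le_1)
qed (simp add: Px.not_empty[unfolded space_Px])

lemma integral_restricted:
  fixes g :: "'w \<Rightarrow> real"
  assumes "G \<in> sets M" "g \<in> borel_measurable M"
  shows "(\<integral>\<omega>. g \<omega> \<partial>restricted x G) = (\<integral>\<omega>. indicator G \<omega> * g \<omega> \<partial>Px x)"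
proof -
  have "restricted x G = density (Px x) (\<lambda>\<omega>. ennreal (indicator G \<omega>))"
    by (simp add: restricted_def ennreal_indicator)
  then show ?thesis using assms by (simp add: integral_density)
qed

lemma markov_law:
  assumes s_nonneg: "0 \<le> s" and t_nonneg: "0 \<le> t" and G_past: "G \<in> sets (past s)"
  shows "distr (restricted x G) borel (X (s + t))
      = distr (restricted x G) borel (X s) \<bind> transition_kernel t"
proof -
  let ?law = "distr (restricted x G) borel (X (s + t))"
    and ?law_s = "distr (restricted x G) borel (X s)"
  have G_sets: "G \<in> sets M" using G_past past_subset by blast
  have [measurable]: "X s \<in> measurable M borel" "X (s + t) \<in> measurable M borel"
    using s_nonneg t_nonneg by (simp_all add: X_measurable)
  note [measurable] = transition_kernel_measurable[OF t_nonneg]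
  interpret restricted: subprob_space "restricted x G" by (rule subprob_space_restricted[OF G_sets])
  interpret law_s: subprob_space ?law_s by (rule restricted.subprob_space_distr) simp_all
  interpret law: subprob_space ?law by (rule restricted.subprob_space_distr) simp_all
  interpret bind: subprob_space "?law_s \<bind> transition_kernel t"
    by (rule subprob_space_bind[where N = borel]) (unfold_locales, measurable)
  show ?thesis
  proof (rule measure_eqI)
    fix A :: "'a set" assume "A \<in> sets ?law"
    then have A_borel [measurable]: "A \<in> sets borel" by simp
    note [measurable] = Ptrans_measurable[OF t_nonneg A_borel]
    have "measure ?law A = (\<integral>z. indicator A z \<partial>?law)" by simp
    also have "\<dots> = (\<integral>\<omega>. indicator A (X (s + t) \<omega>) \<partial>restricted x G)"
      by (rule integral_distr) measurable
    also have "\<dots> = (\<integral>\<omega>. indicator G \<omega> * indicator A (X (s + t) \<omega>) \<partial>Px x)"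
      by (rule integral_restricted[OF G_sets]) measurable
    also have "\<dots> = (\<integral>\<omega>. indicator G \<omega> * Ptrans Px X t (X s \<omega>) A \<partial>Px x)"
      using process s_nonneg t_nonneg A_borel G_past unfolding standard_Feller_Markov_def by blast
    also have "\<dots> = (\<integral>\<omega>. Ptrans Px X t (X s \<omega>) A \<partial>restricted x G)"
      by (rule integral_restricted[OF G_sets, symmetric]) measurable
    also have "\<dots> = (\<integral>y. Ptrans Px X t y A \<partial>?law_s)"
      by (rule integral_distr[symmetric]) measurable
    also have "\<dots> = measure (?law_s \<bind> transition_kernel t) A"
      by (subst law_s.measure_bind[where N = borel])
        (simp_all add: measure_transition_kernel[OF t_nonneg A_borel])
    finally show "emeasure ?law A = emeasure (?law_s \<bind> transition_kernel t) A"
      by (simp add: law.emeasure_eq_measure bind.emeasure_eq_measure)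
  qed (simp add: sets_bind)
qed

lemma markov_P_indicator:
  assumes s_nonneg: "0 \<le> s" and t_nonneg: "0 \<le> t" and G_past: "G \<in> sets (past s)"
    and \<phi>_bounded: "\<phi> \<in> bounded_borel C"
  shows "(\<integral>\<omega>. indicator G \<omega> * \<phi> (X (s + t) \<omega>) \<partial>Px x) = (\<integral>\<omega>. indicator G \<omega> * P t \<phi> (X s \<omega>) \<partial>Px x)"
proof -
  have G_sets: "G \<in> sets M" using G_past past_subset by blast
  interpret restricted: subprob_space "restricted x G" by (rule subprob_space_restricted[OF G_sets])
  have [measurable]: "X s \<in> measurable M borel" "X (s + t) \<in> measurable M borel"
    using s_nonneg t_nonneg by (simp_all add: X_measurable)
  note [measurable] = bounded_borelD(1)[OF \<phi>_bounded]
    bounded_borelD(1)[OF P_bounded_borel[OF t_nonneg \<phi>_bounded]]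
  let ?law_s = "distr (restricted x G) borel (X s)"
  have "(\<integral>\<omega>. indicator G \<omega> * \<phi> (X (s + t) \<omega>) \<partial>Px x) = (\<integral>\<omega>. \<phi> (X (s + t) \<omega>) \<partial>restricted x G)"
    by (rule integral_restricted[OF G_sets, symmetric]) measurable
  also have "\<dots> = (\<integral>z. \<phi> z \<partial>(?law_s \<bind> transition_kernel t))"
    unfolding markov_law[OF s_nonneg t_nonneg G_past, symmetric]
    by (rule integral_distr[symmetric]) measurable
  also have "\<dots> = (\<integral>y. \<integral>z. \<phi> z \<partial>transition_kernel t y \<partial>?law_s)"
  proof (rule integral_bind[where K = borel and B = C and B' = 1])
    show "finite_measure ?law_s" by (rule restricted.finite_measure_distr) simp
    show "AE y in ?law_s. emeasure (transition_kernel t y) (space (transition_kernel t y))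
        \<le> ennreal 1"
      using prob_space.emeasure_space_1[OF prob_space_transition_kernel[OF t_nonneg]] by simp
  qed (use bounded_borelD[OF \<phi>_bounded] transition_kernel_measurable[OF t_nonneg] in simp_all)
  also have "\<dots> = (\<integral>\<omega>. P t \<phi> (X s \<omega>) \<partial>restricted x G)"
    unfolding integral_transition_kernel[OF t_nonneg bounded_borelD(1)[OF \<phi>_bounded]]
    by (rule integral_distr) measurable
  also have "\<dots> = (\<integral>\<omega>. indicator G \<omega> * P t \<phi> (X s \<omega>) \<partial>Px x)"
    by (rule integral_restricted[OF G_sets]) measurable
  finally show ?thesis .
qed

lemma markov_P:
  assumes s_nonneg: "0 \<le> s" and t_nonneg: "0 \<le> t"
    and Y_past: "Y \<in> borel_measurable (past s)" "\<And>\<omega>. \<omega> \<in> space M \<Longrightarrow> \<bar>Y \<omega>\<bar> \<le> K"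
    and \<phi>_bounded: "\<phi> \<in> bounded_borel C"
  shows "(\<integral>\<omega>. Y \<omega> * \<phi> (X (s + t) \<omega>) \<partial>Px x) = (\<integral>\<omega>. Y \<omega> * P t \<phi> (X s \<omega>) \<partial>Px x)"
proof -
  interpret finite_measure_subalgebra "Px x" "past s"
    by unfold_locales (simp add: subalgebra_def past_subset)
  note P_bounded = P_bounded_borel[OF t_nonneg \<phi>_bounded]
  have [measurable]: "X s \<in> measurable M borel" "X (s + t) \<in> measurable M borel"
      "X s \<in> measurable (past s) borel"
    using s_nonneg t_nonneg by (simp_all add: X_measurable X_past_measurable)
  note [measurable] = bounded_borelD(1)[OF \<phi>_bounded] bounded_borelD(1)[OF P_bounded]
    measurable_past[OF Y_past(1)]
  have "AE \<omega> in Px x. real_cond_exp (Px x) (past s) (\<lambda>\<omega>. \<phi> (X (s + t) \<omega>)) \<omega> = P t \<phi> (X s \<omega>)"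
  proof (rule real_cond_exp_charact)
    fix G assume "G \<in> sets (past s)"
    from markov_P_indicator[OF s_nonneg t_nonneg this \<phi>_bounded, of x]
    show "(\<integral>\<omega>\<in>G. \<phi> (X (s + t) \<omega>) \<partial>Px x) = (\<integral>\<omega>\<in>G. P t \<phi> (X s \<omega>) \<partial>Px x)"
      by (simp add: set_lebesgue_integral_def)
  next
    show "integrable (Px x) (\<lambda>\<omega>. \<phi> (X (s + t) \<omega>))" "integrable (Px x) (\<lambda>\<omega>. P t \<phi> (X s \<omega>))"
      using bounded_borelD(2)[OF \<phi>_bounded] bounded_borelD(2)[OF P_bounded]
      by (auto intro!: integrable_bounded[of _ C])
  qed measurable
  then have "(\<integral>\<omega>. Y \<omega> * P t \<phi> (X s \<omega>) \<partial>Px x) =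
      (\<integral>\<omega>. Y \<omega> * real_cond_exp (Px x) (past s) (\<lambda>\<omega>. \<phi> (X (s + t) \<omega>)) \<omega> \<partial>Px x)"
    by (intro integral_cong_AE) auto
  also have "\<dots> = (\<integral>\<omega>. Y \<omega> * \<phi> (X (s + t) \<omega>) \<partial>Px x)"
  proof (rule real_cond_exp_intg(2)[OF _ Y_past(1)])
    show "integrable (Px x) (\<lambda>\<omega>. Y \<omega> * \<phi> (X (s + t) \<omega>))"
      using Y_past(2) bounded_borelD(2)[OF \<phi>_bounded] by (intro integrable_bounded[of _ "K * C"])
        (auto simp: abs_mult intro!: mult_mono order_trans[OF abs_ge_zero Y_past(2)])
  qed measurable
  finally show ?thesis ..
qed

definition path_integral :: "('a \<Rightarrow> real) \<Rightarrow> real \<Rightarrow> real \<Rightarrow> 'w \<Rightarrow> real" where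
  "path_integral g s t \<omega> = integral {s..t} (\<lambda>u. g (X u \<omega>))"

definition FK :: "('a \<Rightarrow> real) \<Rightarrow> real \<Rightarrow> ('a \<Rightarrow> real) \<Rightarrow> 'a \<Rightarrow> real" where
  "FK g t \<phi> x = (\<integral>\<omega>. exp (path_integral g 0 t \<omega>) * \<phi> (X t \<omega>) \<partial>Px x)"

end

subsection \<open>Feynman-Kac operators\<close>

locale feynman_kac = ultra_feller_process M Px X
  for M :: "'w measure" and Px :: "'a::{metric_space, second_countable_topology} \<Rightarrow> 'w measure"
    and X :: "real \<Rightarrow> 'w \<Rightarrow> 'a" +
  fixes f :: "'a \<Rightarrow> real" and F :: real
  assumes f_continuous: "continuous_on UNIV f" and f_bounded: "\<And>x. \<bar>f x\<bar> \<le> F"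
begin

lemma f_measurable [measurable]: "f \<in> borel_measurable borel"
  using f_continuous by (rule borel_measurable_continuous_onI)

lemma F_nonneg: "0 \<le> F"
  using f_bounded[of undefined] by linarith

lemma f_path_right_continuous:
  assumes "\<omega> \<in> space M" "0 \<le> u"
  shows "continuous (at_right u) (\<lambda>u. f (X u \<omega>))"
  using X_right_continuous[OF assms] f_continuous
  by (auto intro!: continuous_within_compose3[where f="\<lambda>s. X s \<omega>"]
    simp: continuous_on_eq_continuous_at)

lemma f_path_integrable:
  assumes "\<omega> \<in> space M" "0 \<le> s"
  shows "(\<lambda>u. f (X u \<omega>)) integrable_on {s..t}"
proof -
  consider "t < s" | "t = s" | "0 < t - s" by linarith
  then show ?thesis
  proof cases
    case 2
    then show ?thesis using integrable_on_refl[of "\<lambda>u. f (X u \<omega>)" s] by simp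
  next
    case 3
    then show ?thesis
      using right_continuous_integrable_on[of "t - s" s "\<lambda>u. f (X u \<omega>)" F] assms
        f_path_right_continuous f_bounded by simp
  qed (simp add: integrable_on_empty)
qed

lemma path_riemann_sum_tendsto:
  assumes "\<omega> \<in> space M" "0 \<le> s" "0 \<le> t"
  shows "(\<lambda>n. right_riemann_sum (\<lambda>u. f (X u \<omega>)) s t (Suc n)) \<longlonglongrightarrow> path_integral f s (s + t) \<omega>"
proof (cases "t = 0")
  case True
  then show ?thesis by (simp add: right_riemann_sum_def path_integral_def)
next
  case False
  then show ?thesis
    unfolding path_integral_def using assms f_path_right_continuous f_bounded
    by (intro right_riemann_sum_tendsto[where C = F]) auto
qed

lemma abs_sum_f_le: "\<bar>\<Sum>i=1..n. f (z i)\<bar> \<le> real n * F"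
  using order_trans[OF sum_abs sum_bounded_above[of "{1..n}" "\<lambda>i. \<bar>f (z i)\<bar>" F]] f_bounded by simp

lemma abs_path_riemann_sum_le:
  assumes "0 \<le> t"
  shows "\<bar>right_riemann_sum (\<lambda>u. f (X u \<omega>)) s t (Suc n)\<bar> \<le> F * t"
proof -
  let ?S = "\<Sum>i=1..Suc n. f (X (s + real i * (t / real (Suc n))) \<omega>)"
  have "\<bar>t / real (Suc n) * ?S\<bar> \<le> t / real (Suc n) * (real (Suc n) * F)"
    unfolding abs_mult using assms by (intro mult_mono abs_sum_f_le) auto
  then show ?thesis by (simp add: right_riemann_sum_def mult.commute)
qed

lemma path_riemann_sum_measurable:
  assumes "0 \<le> s" "0 \<le> t"
  shows "(\<lambda>\<omega>. right_riemann_sum (\<lambda>u. f (X u \<omega>)) s t n) \<in> borel_measurable (past (s + t))"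
proof -
  have "X (s + real i * (t / real n)) \<in> measurable (past (s + t)) borel" if "i \<in> {1..n}" for i
  proof (rule X_past_measurable)
    have "real i * (t / real n) \<le> real n * (t / real n)"
      using that assms by (intro mult_right_mono) auto
    then show "s + real i * (t / real n) \<le> s + t" using that by simp
  qed (use assms in auto)
  then show ?thesis
    unfolding right_riemann_sum_def
    by (intro borel_measurable_times borel_measurable_const borel_measurable_sum) measurable
qed

lemma path_integral_past_measurable:
  assumes "0 \<le> s" "s \<le> t"
  shows "path_integral f s t \<in> borel_measurable (past t)"
proof (rule borel_measurable_LIMSEQ_real)
  show "(\<lambda>n. right_riemann_sum (\<lambda>u. f (X u \<omega>)) s (t - s) (Suc n)) \<longlonglongrightarrow> path_integral f s t \<omega>"
    if "\<omega> \<in> space (past t)" for \<omega>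
    using path_riemann_sum_tendsto[of \<omega> s "t - s"] assms that by simp
  show "(\<lambda>\<omega>. right_riemann_sum (\<lambda>u. f (X u \<omega>)) s (t - s) (Suc n)) \<in> borel_measurable (past t)" for n
    using path_riemann_sum_measurable[of s "t - s"] assms by simp
qed

lemma path_integral_measurable:
  assumes "0 \<le> s" "s \<le> t"
  shows "path_integral f s t \<in> borel_measurable M"
  using path_integral_past_measurable[OF assms] by (rule measurable_past)

lemma abs_path_integral_le:
  assumes "\<omega> \<in> space M" "0 \<le> s" "s \<le> t"
  shows "\<bar>path_integral f s t \<omega>\<bar> \<le> F * (t - s)"
proof (rule LIMSEQ_le_const2[OF tendsto_rabs])
  show "(\<lambda>n. right_riemann_sum (\<lambda>u. f (X u \<omega>)) s (t - s) (Suc n)) \<longlonglongrightarrow> path_integral f s t \<omega>"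
    using path_riemann_sum_tendsto[of \<omega> s "t - s"] assms by simp
qed (use abs_path_riemann_sum_le assms in simp)

lemma path_integral_combine:
  assumes "\<omega> \<in> space M" "0 \<le> s" "s \<le> t"
  shows "path_integral f 0 t \<omega> = path_integral f 0 s \<omega> + path_integral f s t \<omega>"
  unfolding path_integral_def using assms
  by (intro Henstock_Kurzweil_Integration.integral_combine[symmetric] f_path_integrable) auto

lemma path_integral_minus_const:
  assumes "\<omega> \<in> space M" "0 \<le> t"
  shows "path_integral (\<lambda>x. f x - l) 0 t \<omega> = path_integral f 0 t \<omega> - l * t"
  using Henstock_Kurzweil_Integration.integral_diff[OF f_path_integrable[OF assms(1) order_refl, of t]
      integrable_const_ivl[of l 0 t]] assms(2) by (simp add: path_integral_def mult.commute)

lemma FK_minus_const: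
  assumes "0 \<le> t"
  shows "FK (\<lambda>x. f x - l) t \<phi> x = exp (- l * t) * FK f t \<phi> x"
proof -
  have "FK (\<lambda>x. f x - l) t \<phi> x =
      (\<integral>\<omega>. exp (- l * t) * (exp (path_integral f 0 t \<omega>) * \<phi> (X t \<omega>)) \<partial>Px x)"
    unfolding FK_def using assms
    by (intro Bochner_Integration.integral_cong)
      (simp_all add: path_integral_minus_const exp_diff exp_minus field_simps)
  then show ?thesis by (simp add: FK_def)
qed

text \<open>Along right Riemann sums of the exponent the Feynman-Kac operator becomes an iterate of
  transition operators, which inherits the Markov property of \<open>X\<close> at the grid times.\<close>

definition trotter :: "real \<Rightarrow> nat \<Rightarrow> ('a \<Rightarrow> real) \<Rightarrow> 'a \<Rightarrow> real" where
  "trotter h n = (\<lambda>\<phi>. P h (\<lambda>z. exp (h * f z) * \<phi> z)) ^^ n"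

lemma exp_mult_bounded_borel:
  assumes "0 \<le> h" "\<phi> \<in> bounded_borel C"
  shows "(\<lambda>z. exp (h * f z) * \<phi> z) \<in> bounded_borel (exp (F * h) * C)"
proof -
  note [measurable] = bounded_borelD(1)[OF assms(2)]
  have "\<bar>h * f z\<bar> \<le> F * h" for z
    using assms(1) f_bounded[of z] by (simp add: abs_mult mult.commute[of F] mult_left_mono)
  then have "\<bar>exp (h * f z) * \<phi> z\<bar> \<le> exp (F * h) * C" for z
    by (rule abs_exp_mult_le[OF _ bounded_borelD(2)[OF assms(2)]])
  then show ?thesis by (simp add: bounded_borel_def)
qed

lemma trotter_bounded_borel:
  assumes h_nonneg: "0 \<le> h" and \<phi>_bounded: "\<phi> \<in> bounded_borel C"
  shows "trotter h n \<phi> \<in> bounded_borel (exp (F * (real n * h)) * C)"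
proof (induction n)
  case 0
  then show ?case using \<phi>_bounded by (simp add: trotter_def)
next
  case (Suc n)
  have "trotter h (Suc n) \<phi> = P h (\<lambda>z. exp (h * f z) * trotter h n \<phi> z)"
    by (simp add: trotter_def)
  moreover have "exp (F * h) * (exp (F * (real n * h)) * C) = exp (F * (real (Suc n) * h)) * C"
    by (simp add: exp_add[symmetric] algebra_simps)
  ultimately show ?case
    using P_bounded_borel[OF h_nonneg exp_mult_bounded_borel[OF h_nonneg Suc]] by metis
qed

lemma markov_trotter_grid:
  assumes s_nonneg: "0 \<le> s" and h_nonneg: "0 \<le> h"
    and Y_past: "Y \<in> borel_measurable (past s)" "\<And>\<omega>. \<omega> \<in> space M \<Longrightarrow> \<bar>Y \<omega>\<bar> \<le> K"
    and \<phi>_bounded: "\<phi> \<in> bounded_borel C"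
  shows "(\<integral>\<omega>. Y \<omega> * (exp (h * (\<Sum>i=1..n. f (X (s + real i * h) \<omega>)))
      * \<phi> (X (s + real n * h) \<omega>)) \<partial>Px x) =
    (\<integral>\<omega>. Y \<omega> * trotter h n \<phi> (X s \<omega>) \<partial>Px x)"
  using \<phi>_bounded
proof (induction n arbitrary: \<phi> C)
  case 0
  then show ?case by (simp add: trotter_def)
next
  case (Suc n)
  let ?\<psi> = "\<lambda>z. exp (h * f z) * \<phi> z"
  let ?S = "\<lambda>\<omega>. \<Sum>i=1..n. f (X (s + real i * h) \<omega>)"
  note \<psi>_bounded = exp_mult_bounded_borel[OF h_nonneg Suc.prems]
  have [measurable]: "Y \<in> borel_measurable (past (s + real n * h))"
    using h_nonneg by (intro measurable_past_mono[OF _ Y_past(1)]) simp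
  have [measurable]: "X (s + real i * h) \<in> measurable (past (s + real n * h)) borel"
    if "i \<in> {1..n}" for i
    using that s_nonneg h_nonneg by (intro X_past_measurable) (auto intro: mult_right_mono)
  have [measurable]: "?S \<in> borel_measurable (past (s + real n * h))"
    by (intro borel_measurable_sum) measurable
  have Y_exp_bounded: "\<bar>Y \<omega> * exp (h * ?S \<omega>)\<bar> \<le> exp (h * (real n * F)) * K" if "\<omega> \<in> space M" for \<omega>
  proof -
    have "\<bar>h * ?S \<omega>\<bar> \<le> h * (real n * F)"
      using h_nonneg abs_sum_f_le by (simp add: abs_mult mult_left_mono)
    from abs_exp_mult_le[OF this Y_past(2)[OF that]] show ?thesis by (simp add: mult.commute)
  qed
  have "(\<integral>\<omega>. Y \<omega> * (exp (h * (\<Sum>i=1..Suc n. f (X (s + real i * h) \<omega>)))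
      * \<phi> (X (s + real (Suc n) * h) \<omega>)) \<partial>Px x) =
      (\<integral>\<omega>. (Y \<omega> * exp (h * ?S \<omega>)) * ?\<psi> (X (s + real n * h + h) \<omega>) \<partial>Px x)"
    by (intro Bochner_Integration.integral_cong refl) (simp add: algebra_simps exp_add)
  also have "\<dots> = (\<integral>\<omega>. (Y \<omega> * exp (h * ?S \<omega>)) * P h ?\<psi> (X (s + real n * h) \<omega>) \<partial>Px x)"
    using s_nonneg h_nonneg by (intro markov_P[OF _ h_nonneg _ Y_exp_bounded \<psi>_bounded]) auto
  also have "\<dots> = (\<integral>\<omega>. Y \<omega> * trotter h n (P h ?\<psi>) (X s \<omega>) \<partial>Px x)"
    using Suc.IH[OF P_bounded_borel[OF h_nonneg \<psi>_bounded]] by (simp add: mult.assoc)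
  also have "trotter h n (P h ?\<psi>) = trotter h (Suc n) \<phi>"
    unfolding trotter_def funpow_Suc_right by simp
  finally show ?case .
qed

lemma markov_trotter:
  assumes "0 \<le> s" "0 \<le> t"
    and "Y \<in> borel_measurable (past s)" "\<And>\<omega>. \<omega> \<in> space M \<Longrightarrow> \<bar>Y \<omega>\<bar> \<le> K"
    and "\<phi> \<in> bounded_borel C"
  shows "(\<integral>\<omega>. Y \<omega> * (exp (right_riemann_sum (\<lambda>u. f (X u \<omega>)) s t (Suc n)) * \<phi> (X (s + t) \<omega>)) \<partial>Px x) =
    (\<integral>\<omega>. Y \<omega> * trotter (t / real (Suc n)) (Suc n) \<phi> (X s \<omega>) \<partial>Px x)"
  using markov_trotter_grid[OF assms(1) _ assms(3-5), of "t / real (Suc n)" x "Suc n"] assms(2)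
  by (simp add: right_riemann_sum_def del: sum.cl_ivl_Suc of_nat_Suc)

lemma riemann_expectation_tendsto:
  assumes s_nonneg: "0 \<le> s" and t_nonneg: "0 \<le> t"
    and [measurable]: "Y \<in> borel_measurable M"
    and Y_le: "\<And>\<omega>. \<omega> \<in> space M \<Longrightarrow> \<bar>Y \<omega>\<bar> \<le> K"
    and \<phi>_bounded: "\<phi> \<in> bounded_borel C"
  shows "(\<lambda>n. \<integral>\<omega>. Y \<omega> * (exp (right_riemann_sum (\<lambda>u. f (X u \<omega>)) s t (Suc n)) *
        \<phi> (X (s + t) \<omega>)) \<partial>Px x)
    \<longlonglongrightarrow> (\<integral>\<omega>. Y \<omega> * (exp (path_integral f s (s + t) \<omega>) * \<phi> (X (s + t) \<omega>)) \<partial>Px x)"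
proof (rule bounded_convergence[where K = "K * (exp (F * t) * C)"])
  let ?R = "\<lambda>n \<omega>. right_riemann_sum (\<lambda>u. f (X u \<omega>)) s t (Suc n)"
  note [measurable] = bounded_borelD(1)[OF \<phi>_bounded]
    X_measurable[OF add_nonneg_nonneg[OF s_nonneg t_nonneg]]
    path_riemann_sum_measurable[OF s_nonneg t_nonneg, THEN measurable_past]
  show "(\<lambda>\<omega>. Y \<omega> * (exp (?R n \<omega>) * \<phi> (X (s + t) \<omega>))) \<in> borel_measurable M" for n
    by measurable
  fix \<omega> assume \<omega>_space: "\<omega> \<in> space M"
  have "\<bar>exp (?R n \<omega>) * \<phi> (X (s + t) \<omega>)\<bar> \<le> exp (F * t) * C" for n
    by (rule abs_exp_mult_le[OF abs_path_riemann_sum_le[OF t_nonneg]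
      bounded_borelD(2)[OF \<phi>_bounded]])
  then show "\<bar>Y \<omega> * (exp (?R n \<omega>) * \<phi> (X (s + t) \<omega>))\<bar> \<le> K * (exp (F * t) * C)" for n
    unfolding abs_mult[of "Y \<omega>"] using Y_le[OF \<omega>_space] by (intro mult_mono) auto
  show "(\<lambda>n. Y \<omega> * (exp (?R n \<omega>) * \<phi> (X (s + t) \<omega>)))
      \<longlonglongrightarrow> Y \<omega> * (exp (path_integral f s (s + t) \<omega>) * \<phi> (X (s + t) \<omega>))"
    by (intro tendsto_intros path_riemann_sum_tendsto \<omega>_space s_nonneg t_nonneg)
qed

lemma trotter_tendsto_FK:
  assumes t_nonneg: "0 \<le> t" and \<phi>_bounded: "\<phi> \<in> bounded_borel C"
  shows "(\<lambda>n. trotter (t / real (Suc n)) (Suc n) \<phi> y) \<longlonglongrightarrow> FK f t \<phi> y"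
proof -
  have "(\<integral>\<omega>. exp (right_riemann_sum (\<lambda>u. f (X u \<omega>)) 0 t (Suc n)) * \<phi> (X t \<omega>) \<partial>Px y) =
      trotter (t / real (Suc n)) (Suc n) \<phi> y" for n
    using markov_trotter[OF order_refl t_nonneg, of "\<lambda>_. 1" 1 \<phi> C y n] \<phi>_bounded t_nonneg
      P_0[OF bounded_borelD(1)[OF trotter_bounded_borel[OF _ \<phi>_bounded,
        of "t / real (Suc n)" "Suc n"]], of y]
    by (simp add: P_def)
  then show ?thesis
    using riemann_expectation_tendsto[OF order_refl t_nonneg, of "\<lambda>_. 1" 1 \<phi> C y] \<phi>_bounded
    by (simp add: FK_def)
qed

lemma FK_bounded_borel:
  assumes t_nonneg: "0 \<le> t" and \<phi>_bounded: "\<phi> \<in> bounded_borel C"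
  shows "FK f t \<phi> \<in> bounded_borel (exp (F * t) * C)"
proof -
  have trotter_bounded: "trotter (t / real (Suc n)) (Suc n) \<phi> \<in> bounded_borel (exp (F * t) * C)"
    for n
    using trotter_bounded_borel[OF _ \<phi>_bounded, of "t / real (Suc n)" "Suc n"] t_nonneg by simp
  have "FK f t \<phi> \<in> borel_measurable borel"
    by (rule borel_measurable_LIMSEQ_real[OF trotter_tendsto_FK[OF t_nonneg \<phi>_bounded]
      bounded_borelD(1)[OF trotter_bounded]])
  moreover have "\<bar>FK f t \<phi> y\<bar> \<le> exp (F * t) * C" for y
    by (rule LIMSEQ_le_const2[OF tendsto_rabs[OF trotter_tendsto_FK[OF t_nonneg \<phi>_bounded]]])
      (use bounded_borelD(2)[OF trotter_bounded] in blast)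
  ultimately show ?thesis by (simp add: bounded_borel_def)
qed

lemma trotter_expectation_tendsto:
  assumes s_nonneg: "0 \<le> s" and t_nonneg: "0 \<le> t"
    and [measurable]: "Y \<in> borel_measurable M"
    and Y_le: "\<And>\<omega>. \<omega> \<in> space M \<Longrightarrow> \<bar>Y \<omega>\<bar> \<le> K"
    and \<phi>_bounded: "\<phi> \<in> bounded_borel C"
  shows "(\<lambda>n. \<integral>\<omega>. Y \<omega> * trotter (t / real (Suc n)) (Suc n) \<phi> (X s \<omega>) \<partial>Px x)
    \<longlonglongrightarrow> (\<integral>\<omega>. Y \<omega> * FK f t \<phi> (X s \<omega>) \<partial>Px x)"
proof (rule bounded_convergence[where K = "K * (exp (F * t) * C)"])
  have trotter_bounded: "trotter (t / real (Suc n)) (Suc n) \<phi> \<in> bounded_borel (exp (F * t) * C)"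
    for n
    using trotter_bounded_borel[OF _ \<phi>_bounded, of "t / real (Suc n)" "Suc n"] t_nonneg by simp
  note [measurable] = X_measurable[OF s_nonneg] bounded_borelD(1)[OF trotter_bounded]
  show "(\<lambda>\<omega>. Y \<omega> * trotter (t / real (Suc n)) (Suc n) \<phi> (X s \<omega>)) \<in> borel_measurable M" for n
    by measurable
  fix \<omega> assume \<omega>_space: "\<omega> \<in> space M"
  show "\<bar>Y \<omega> * trotter (t / real (Suc n)) (Suc n) \<phi> (X s \<omega>)\<bar> \<le> K * (exp (F * t) * C)" for n
    unfolding abs_mult using Y_le[OF \<omega>_space] bounded_borelD(2)[OF trotter_bounded]
    by (intro mult_mono) (auto intro: order_trans[OF abs_ge_zero])
  show "(\<lambda>n. Y \<omega> * trotter (t / real (Suc n)) (Suc n) \<phi> (X s \<omega>)) \<longlonglongrightarrow> Y \<omega> * FK f t \<phi> (X s \<omega>)"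
    by (intro tendsto_intros trotter_tendsto_FK[OF t_nonneg \<phi>_bounded])
qed

lemma markov_FK:
  assumes s_nonneg: "0 \<le> s" and t_nonneg: "0 \<le> t"
    and Y_past: "Y \<in> borel_measurable (past s)" "\<And>\<omega>. \<omega> \<in> space M \<Longrightarrow> \<bar>Y \<omega>\<bar> \<le> K"
    and \<phi>_bounded: "\<phi> \<in> bounded_borel C"
  shows "(\<integral>\<omega>. Y \<omega> * (exp (path_integral f s (s + t) \<omega>) * \<phi> (X (s + t) \<omega>)) \<partial>Px x) =
    (\<integral>\<omega>. Y \<omega> * FK f t \<phi> (X s \<omega>) \<partial>Px x)"
proof (rule LIMSEQ_unique)
  let ?E = "\<lambda>n. \<integral>\<omega>. Y \<omega> * (exp (right_riemann_sum (\<lambda>u. f (X u \<omega>)) s t (Suc n))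
      * \<phi> (X (s + t) \<omega>)) \<partial>Px x"
  show "?E \<longlonglongrightarrow> (\<integral>\<omega>. Y \<omega> * (exp (path_integral f s (s + t) \<omega>) * \<phi> (X (s + t) \<omega>)) \<partial>Px x)"
    by (rule riemann_expectation_tendsto[OF s_nonneg t_nonneg measurable_past[OF Y_past(1)]
      Y_past(2) \<phi>_bounded])
  have "?E n = (\<integral>\<omega>. Y \<omega> * trotter (t / real (Suc n)) (Suc n) \<phi> (X s \<omega>) \<partial>Px x)" for n
    by (rule markov_trotter[OF s_nonneg t_nonneg Y_past \<phi>_bounded])
  then show "?E \<longlonglongrightarrow> (\<integral>\<omega>. Y \<omega> * FK f t \<phi> (X s \<omega>) \<partial>Px x)"
    using trotter_expectation_tendsto[OF s_nonneg t_nonneg measurable_past[OF Y_past(1)] Y_past(2)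
      \<phi>_bounded] by simp
qed

lemma FK_integrand_measurable:
  assumes "0 \<le> s" "s \<le> t" "\<phi> \<in> bounded_borel C"
  shows "(\<lambda>\<omega>. exp (path_integral f s t \<omega>) * \<phi> (X t \<omega>)) \<in> borel_measurable M"
proof -
  have [measurable]: "X t \<in> measurable M borel" using assms by (simp add: X_measurable)
  note [measurable] = path_integral_measurable[OF assms(1,2)] bounded_borelD(1)[OF assms(3)]
  show ?thesis by measurable
qed

lemma abs_FK_integrand_le:
  assumes "0 \<le> s" "s \<le> t" "\<phi> \<in> bounded_borel C" "\<omega> \<in> space M"
  shows "\<bar>exp (path_integral f s t \<omega>) * \<phi> (X t \<omega>)\<bar> \<le> exp (F * (t - s)) * C"
  using assms by (intro abs_exp_mult_le abs_path_integral_le bounded_borelD(2))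

lemma FK_integrand_integrable:
  assumes "0 \<le> s" "s \<le> t" "\<phi> \<in> bounded_borel C"
  shows "integrable (Px x) (\<lambda>\<omega>. exp (path_integral f s t \<omega>) * \<phi> (X t \<omega>))"
  using assms by (intro integrable_bounded[OF FK_integrand_measurable abs_FK_integrand_le])

lemma FK_0:
  assumes "\<phi> \<in> bounded_borel C"
  shows "FK f 0 \<phi> x = \<phi> x"
  using P_0[OF bounded_borelD(1)[OF assms]] by (simp add: FK_def path_integral_def P_def)

lemma FK_semigroup:
  assumes s_nonneg: "0 \<le> s" and t_nonneg: "0 \<le> t" and \<phi>_bounded: "\<phi> \<in> bounded_borel C"
  shows "FK f (s + t) \<phi> x = FK f s (FK f t \<phi>) x"
proof -
  have "FK f (s + t) \<phi> x =
      (\<integral>\<omega>. exp (path_integral f 0 s \<omega>) *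
        (exp (path_integral f s (s + t) \<omega>) * \<phi> (X (s + t) \<omega>)) \<partial>Px x)"
    unfolding FK_def using s_nonneg t_nonneg
    by (intro Bochner_Integration.integral_cong)
      (simp_all add: path_integral_combine[of _ s "s + t"] exp_add)
  also have "\<dots> = FK f s (FK f t \<phi>) x"
    unfolding FK_def[of f s]
  proof (rule markov_FK[OF s_nonneg t_nonneg _ _ \<phi>_bounded])
    show "(\<lambda>\<omega>. exp (path_integral f 0 s \<omega>)) \<in> borel_measurable (past s)"
      using path_integral_past_measurable[OF order_refl s_nonneg] by measurable
    show "\<bar>exp (path_integral f 0 s \<omega>)\<bar> \<le> exp (F * s)" if "\<omega> \<in> space M" for \<omega>
      using abs_path_integral_le[OF that order_refl s_nonneg] by simp
  qed
  finally show ?thesis .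
qed

lemma FK_mono:
  assumes "0 \<le> t" "\<phi> \<in> bounded_borel C" "\<psi> \<in> bounded_borel D" "\<And>z. \<phi> z \<le> \<psi> z"
  shows "FK f t \<phi> x \<le> FK f t \<psi> x"
  unfolding FK_def using assms
  by (intro integral_mono FK_integrand_integrable) (auto intro!: mult_left_mono)

lemma FK_add:
  assumes "0 \<le> t" "\<phi> \<in> bounded_borel C" "\<psi> \<in> bounded_borel D"
  shows "FK f t (\<lambda>z. \<phi> z + \<psi> z) x = FK f t \<phi> x + FK f t \<psi> x"
  unfolding FK_def distrib_left using assms
  by (intro Bochner_Integration.integral_add FK_integrand_integrable) auto

lemma FK_cmult: "FK f t (\<lambda>z. k * \<phi> z) x = k * FK f t \<phi> x"
  unfolding FK_def by (subst integral_mult_right_zero[symmetric]) (simp add: mult.left_commute)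

lemma one_bounded_borel: "(\<lambda>_. 1) \<in> bounded_borel 1"
  by (simp add: bounded_borel_def)

lemma FK_lower:
  assumes t_nonneg: "0 \<le> t" and \<phi>_bounded: "\<phi> \<in> bounded_borel C" and a_lower: "0 \<le> a" "\<And>z. a \<le> \<phi> z"
  shows "exp (- F * t) * a \<le> FK f t \<phi> x"
  unfolding FK_def
proof (rule Px.integral_ge_const[OF FK_integrand_integrable[OF order_refl t_nonneg \<phi>_bounded]
  AE_I2])
  fix \<omega> assume "\<omega> \<in> space (Px x)"
  then show "exp (- F * t) * a \<le> exp (path_integral f 0 t \<omega>) * \<phi> (X t \<omega>)"
    using abs_path_integral_le[of \<omega> 0 t] t_nonneg a_lower by (intro mult_mono) auto
qed

lemma FK_exp_lower:
  assumes t_nonneg: "0 \<le> t" and w_bounded: "w \<in> bounded_borel C"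
  shows "exp (- (F * t + C)) \<le> FK f t (\<lambda>z. exp (w z)) x"
proof -
  have "- C \<le> w z" for z using bounded_borelD(2)[OF w_bounded, of z] by (simp add: abs_le_iff)
  then have "exp (- F * t) * exp (- C) \<le> FK f t (\<lambda>z. exp (w z)) x"
    by (intro FK_lower[OF t_nonneg exp_bounded_borel[OF w_bounded]]) simp_all
  then show ?thesis by (simp add: exp_add[symmetric] del: minus_mult_left)
qed

lemma FK_tendsto:
  assumes t_nonneg: "0 \<le> t" and \<phi>_bounded: "\<And>n. \<phi> n \<in> bounded_borel C"
    and pointwise: "\<And>z. (\<lambda>n. \<phi> n z) \<longlonglongrightarrow> \<psi> z"
  shows "(\<lambda>n. FK f t (\<phi> n) x) \<longlonglongrightarrow> FK f t \<psi> x"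
  unfolding FK_def
proof (rule bounded_convergence)
  show "(\<lambda>\<omega>. exp (path_integral f 0 t \<omega>) * \<phi> n (X t \<omega>)) \<in> borel_measurable M" for n
    by (rule FK_integrand_measurable[OF order_refl t_nonneg \<phi>_bounded])
  show "\<bar>exp (path_integral f 0 t \<omega>) * \<phi> n (X t \<omega>)\<bar> \<le> exp (F * (t - 0)) * C"
    if "\<omega> \<in> space M" for n \<omega>
    by (rule abs_FK_integrand_le[OF order_refl t_nonneg \<phi>_bounded that])
  show "(\<lambda>n. exp (path_integral f 0 t \<omega>) * \<phi> n (X t \<omega>))
      \<longlonglongrightarrow> exp (path_integral f 0 t \<omega>) * \<psi> (X t \<omega>)" for \<omega>
    by (intro tendsto_intros pointwise)
qed

subsection \<open>Equicontinuity of the Feynman-Kac operators\<close>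

lemma FK_drop_initial:
  assumes h_bounds: "0 \<le> h" "h \<le> t" and \<phi>_bounded: "\<phi> \<in> bounded_borel C"
  shows "\<bar>FK f t \<phi> y - P h (FK f (t - h) \<phi>) y\<bar> \<le> (exp (F * h) - 1) * (exp (F * (t - h)) * C)"
proof -
  have t_nonneg: "0 \<le> t" using h_bounds by simp
  let ?g = "\<lambda>s \<omega>. exp (path_integral f s t \<omega>) * \<phi> (X t \<omega>)"
  have "P h (FK f (t - h) \<phi>) y = (\<integral>\<omega>. ?g h \<omega> \<partial>Px y)"
    unfolding P_def using markov_FK[of h "t - h" "\<lambda>_. 1" 1 \<phi> C y] h_bounds \<phi>_bounded by simp
  then have "FK f t \<phi> y - P h (FK f (t - h) \<phi>) y = (\<integral>\<omega>. ?g 0 \<omega> - ?g h \<omega> \<partial>Px y)"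
    unfolding FK_def using FK_integrand_integrable[OF order_refl t_nonneg \<phi>_bounded]
      FK_integrand_integrable[OF h_bounds \<phi>_bounded]
    by (simp add: Bochner_Integration.integral_diff)
  also have "\<bar>\<dots>\<bar> \<le> (exp (F * h) - 1) * (exp (F * (t - h)) * C)"
  proof (rule abs_integral_le)
    show "(\<lambda>\<omega>. ?g 0 \<omega> - ?g h \<omega>) \<in> borel_measurable M"
      using FK_integrand_measurable[OF order_refl t_nonneg \<phi>_bounded]
        FK_integrand_measurable[OF h_bounds \<phi>_bounded] by measurable
    fix \<omega> assume \<omega>_space: "\<omega> \<in> space M"
    have diff_eq: "?g 0 \<omega> - ?g h \<omega> = (exp (path_integral f 0 h \<omega>) - 1) * ?g h \<omega>"
      unfolding path_integral_combine[OF \<omega>_space h_bounds] exp_add by (simp add: algebra_simps)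
    have "\<bar>exp (path_integral f 0 h \<omega>) - 1\<bar> \<le> exp (F * h) - 1"
      using abs_path_integral_le[OF \<omega>_space order_refl h_bounds(1)]
      by (intro abs_exp_diff_one_le) simp
    moreover have "\<bar>?g h \<omega>\<bar> \<le> exp (F * (t - h)) * C"
      by (rule abs_FK_integrand_le[OF h_bounds \<phi>_bounded \<omega>_space])
    ultimately show "\<bar>?g 0 \<omega> - ?g h \<omega>\<bar> \<le> (exp (F * h) - 1) * (exp (F * (t - h)) * C)"
      unfolding diff_eq abs_mult[of "_ - 1"] using F_nonneg h_bounds(1) by (intro mult_mono) auto
  qed
  finally show ?thesis .
qed

theorem FK_equicontinuous:
  assumes t_pos: "0 < t"
  shows "equicontinuous (bounded_borel C) (FK f t)"
proof (rule equicontinuous_uniform_approximation)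
  fix \<epsilon> :: real assume \<epsilon>_pos: "0 < \<epsilon>"
  have "((\<lambda>h. (exp (F * h) - 1) * (exp (F * (t - h)) * C)) \<longlongrightarrow> (exp (F * 0) - 1)
      * (exp (F * (t - 0)) * C)) (at_right 0)"
    by (intro tendsto_intros)
  then have "\<forall>\<^sub>F h in at_right 0. (exp (F * h) - 1) * (exp (F * (t - h)) * C) < \<epsilon>"
    using \<epsilon>_pos by (auto dest: order_tendstoD)
  moreover have "\<forall>\<^sub>F h in at_right 0. h \<in> {0<..<t}"
    using t_pos by (rule eventually_at_right_real)
  ultimately obtain h where h_small: "0 < h" "h < t" "(exp (F * h) - 1) * (exp (F * (t - h)) * C)
      < \<epsilon>"
    using eventually_happens'[OF trivial_limit_at_right_real eventually_conj] by force
  have "equicontinuous (bounded_borel C) (\<lambda>\<phi>. P h (FK f (t - h) \<phi>))"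
    using h_small by (intro equicontinuous_reindex[OF P_equicontinuous])
      (auto intro!: FK_bounded_borel)
  moreover have "dist (FK f t \<phi> x) (P h (FK f (t - h) \<phi>) x) < \<epsilon>" if "\<phi> \<in> bounded_borel C" for \<phi> x
    using FK_drop_initial[of h t \<phi> C x] that h_small by (simp add: dist_real_def)
  ultimately show "\<exists>w. equicontinuous (bounded_borel C) w \<and>
      (\<forall>\<phi>\<in>bounded_borel C. \<forall>x. dist (FK f t \<phi> x) (w \<phi> x) < \<epsilon>)"
    by blast
qed

subsection \<open>Exponential growth rate\<close>

definition total_mass :: "real \<Rightarrow> real" where
  "total_mass t = (SUP x. FK f t (\<lambda>_. 1) x)"

lemma FK_one_bounds:
  assumes "0 \<le> t"
  shows "FK f t (\<lambda>_. 1) x \<in> {exp (- F * t)..exp (F * t)}"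
  using bounded_borelD(2)[OF FK_bounded_borel[OF assms one_bounded_borel], of x]
    FK_lower[OF assms one_bounded_borel, of 1 x] by (simp add: abs_le_iff)

lemma FK_one_le_total_mass:
  assumes "0 \<le> t"
  shows "FK f t (\<lambda>_. 1) x \<le> total_mass t"
  unfolding total_mass_def using FK_one_bounds[OF assms]
  by (intro cSUP_upper bdd_aboveI2[of _ _ "exp (F * t)"]) simp_all

lemma total_mass_bounds:
  assumes "0 \<le> t"
  shows "total_mass t \<in> {exp (- F * t)..exp (F * t)}"
proof -
  have "total_mass t \<le> exp (F * t)"
    unfolding total_mass_def using FK_one_bounds[OF assms] by (intro cSUP_least) simp_all
  moreover have "exp (- F * t) \<le> total_mass t"
    using FK_one_bounds[OF assms, of undefined] FK_one_le_total_mass[OF assms, of undefined] by simp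
  ultimately show ?thesis by simp
qed

lemma total_mass_pos: "0 \<le> t \<Longrightarrow> 0 < total_mass t"
  using total_mass_bounds[of t] less_le_trans[OF exp_gt_zero] by auto

lemma total_mass_submultiplicative:
  assumes "0 \<le> s" "0 \<le> t"
  shows "total_mass (s + t) \<le> total_mass s * total_mass t"
  unfolding total_mass_def[of "s + t"]
proof (rule cSUP_least)
  fix x
  have const_bounded: "(\<lambda>_. total_mass t * 1) \<in> bounded_borel (total_mass t)"
    using total_mass_pos[OF assms(2)] by (simp add: bounded_borel_def)
  have "FK f (s + t) (\<lambda>_. 1) x = FK f s (FK f t (\<lambda>_. 1)) x"
    by (rule FK_semigroup[OF assms one_bounded_borel])
  also have "\<dots> \<le> FK f s (\<lambda>_. total_mass t * 1) x"
    using FK_one_le_total_mass[OF assms(2)]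
    by (intro FK_mono[OF assms(1) FK_bounded_borel[OF assms(2) one_bounded_borel]
      const_bounded]) simp
  also have "\<dots> = total_mass t * FK f s (\<lambda>_. 1) x" by (rule FK_cmult)
  also have "\<dots> \<le> total_mass t * total_mass s"
    using total_mass_pos[OF assms(2)] FK_one_le_total_mass[OF assms(1)]
    by (intro mult_left_mono) auto
  finally show "FK f (s + t) (\<lambda>_. 1) x \<le> total_mass s * total_mass t" by (simp add: mult.commute)
qed simp

theorem ln_total_mass_tendsto_rate: "((\<lambda>t. ln (total_mass t) / t) \<longlongrightarrow> rate Px X f) at_top"
proof -
  have abs_ln_le: "\<bar>ln (total_mass t)\<bar> \<le> F * t" if "0 \<le> t" for t
  proof -
    have "ln (exp (- F * t)) \<le> ln (total_mass t)" "ln (total_mass t) \<le> ln (exp (F * t))"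
      using total_mass_bounds[OF that] total_mass_pos[OF that]
      by (auto simp only: ln_le_cancel_iff exp_gt_zero atLeastAtMost_iff)
    then show ?thesis by (simp add: abs_le_iff)
  qed
  have tendsto_INF: "((\<lambda>t. ln (total_mass t) / t) \<longlongrightarrow> (INF t\<in>{0<..}. ln (total_mass t) / t)) at_top"
  proof (rule subadditive_tendsto_INF)
    fix s t :: real assume nonneg: "0 \<le> s" "0 \<le> t"
    have "ln (total_mass (s + t)) \<le> ln (total_mass s * total_mass t)"
      using total_mass_submultiplicative[OF nonneg] total_mass_pos nonneg by (intro ln_mono) auto
    then show "ln (total_mass (s + t)) \<le> ln (total_mass s) + ln (total_mass t)"
      using total_mass_pos nonneg by (simp add: ln_mult_pos)
  next
    fix t :: real
    have "ln (total_mass s) \<le> F * t" if "s \<in> {0..t}" for s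
      using abs_ln_le[of s] mult_left_mono[of s t F] F_nonneg that by (simp add: abs_le_iff)
    then show "bdd_above ((\<lambda>t. ln (total_mass t)) ` {0..t})" by (rule bdd_aboveI2)
  next
    have "- F \<le> ln (total_mass t) / t" if "t \<in> {0<..}" for t
      using abs_ln_le[of t] that by (simp add: field_simps abs_le_iff)
    then show "bdd_below ((\<lambda>t. ln (total_mass t) / t) ` {0<..})" by (rule bdd_belowI2)
  qed
  have "rate Px X f = Lim at_top (\<lambda>t. ln (total_mass t) / t)"
    by (simp add: rate_def total_mass_def FK_def path_integral_def)
  also have "\<dots> = (INF t\<in>{0<..}. ln (total_mass t) / t)"
    by (rule tendsto_Lim[OF _ tendsto_INF]) simp
  finally show ?thesis using tendsto_INF by simp
qed

lemma feynman_kac_minus_const: "feynman_kac M Px X (\<lambda>x. f x - l) (F + \<bar>l\<bar>)"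
proof
  show "continuous_on UNIV (\<lambda>x. f x - l)" using f_continuous by (intro continuous_intros)
  show "\<bar>f x - l\<bar> \<le> F + \<bar>l\<bar>" for x using f_bounded[of x] by linarith
qed

interpretation discounted: feynman_kac M Px X "\<lambda>x. f x - l" "F + \<bar>l\<bar>" for l
  by (rule feynman_kac_minus_const)

lemma total_mass_minus_const:
  assumes t_nonneg: "0 \<le> t"
  shows "discounted.total_mass l t = exp (- l * t) * total_mass t"
proof (rule antisym)
  show "discounted.total_mass l t \<le> exp (- l * t) * total_mass t"
    unfolding discounted.total_mass_def FK_minus_const[OF t_nonneg]
    by (intro cSUP_least mult_left_mono FK_one_le_total_mass[OF t_nonneg]) simp_all
  have "FK f t (\<lambda>_. 1) x \<le> exp (l * t) * discounted.total_mass l t" for x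
  proof -
    have "exp (l * t) * (exp (- l * t) * FK f t (\<lambda>_. 1) x)
        \<le> exp (l * t) * discounted.total_mass l t"
      unfolding FK_minus_const[OF t_nonneg, symmetric]
      by (intro mult_left_mono discounted.FK_one_le_total_mass[OF t_nonneg]) simp
    then show ?thesis by (simp add: mult.assoc[symmetric] exp_add[symmetric])
  qed
  then have "total_mass t \<le> exp (l * t) * discounted.total_mass l t"
    unfolding total_mass_def by (intro cSUP_least) simp_all
  then show "exp (- l * t) * total_mass t \<le> discounted.total_mass l t"
    by (simp add: exp_minus field_simps)
qed

lemma rate_minus_const: "rate Px X (\<lambda>x. f x - l) = rate Px X f - l"
proof (rule tendsto_unique[OF _ discounted.ln_total_mass_tendsto_rate])
  have "ln (total_mass t) / t - l = ln (discounted.total_mass l t) / t" if "0 < t" for t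
    using that total_mass_pos[of t] by (simp add: total_mass_minus_const ln_mult_pos field_simps)
  then have "\<forall>\<^sub>F t in at_top. ln (total_mass t) / t - l = ln (discounted.total_mass l t) / t"
    by (rule eventually_mono[OF eventually_gt_at_top[of 0]])
  moreover have "((\<lambda>t. ln (total_mass t) / t - l) \<longlongrightarrow> rate Px X f - l) at_top"
    by (intro tendsto_intros ln_total_mass_tendsto_rate)
  ultimately show "((\<lambda>t. ln (discounted.total_mass l t) / t) \<longlongrightarrow> rate Px X f - l) at_top"
    by (rule Lim_transform_eventually[rotated])
qed simp

lemma FK_one_exponential_growth:
  assumes rate_less: "rate Px X f < l"
  obtains K where "1 \<le> K" "\<And>t x. 0 \<le> t \<Longrightarrow> FK f t (\<lambda>_. 1) x \<le> K * exp (l * t)"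
proof -
  have "\<forall>\<^sub>F t in at_top. 0 < t \<and> ln (total_mass t) / t < l"
    by (intro eventually_conj eventually_gt_at_top
      order_tendstoD(2)[OF ln_total_mass_tendsto_rate rate_less])
  then obtain p where p_growth: "\<And>t. p \<le> t \<Longrightarrow> 0 < t \<and> ln (total_mass t) / t < l"
    unfolding eventually_at_top_linorder by blast
  have p_pos: "0 < p" using p_growth by blast
  have "total_mass t \<le> exp ((F + \<bar>l\<bar>) * p) * exp (l * t)" if t_nonneg: "0 \<le> t" for t
  proof (cases "p \<le> t")
    case True
    then have "ln (total_mass t) \<le> l * t"
      using p_growth[of t] by (metis less_imp_le pos_divide_less_eq)
    then have "total_mass t \<le> exp (l * t)"
      using total_mass_pos[OF t_nonneg] by (metis exp_le_cancel_iff exp_ln)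
    also have "\<dots> \<le> exp ((F + \<bar>l\<bar>) * p) * exp (l * t)" using p_pos F_nonneg by simp
    finally show ?thesis .
  next
    case False
    have "F * t - l * t \<le> (F + \<bar>l\<bar>) * t"
      using t_nonneg abs_ge_minus_self[of "l * t"] by (simp add: algebra_simps abs_mult)
    also have "\<dots> \<le> (F + \<bar>l\<bar>) * p" using False F_nonneg by (intro mult_left_mono) auto
    finally have "exp (F * t) \<le> exp ((F + \<bar>l\<bar>) * p) * exp (l * t)" by (simp add: exp_add[symmetric])
    then show ?thesis using total_mass_bounds[OF t_nonneg] by simp
  qed
  then have "FK f t (\<lambda>_. 1) x \<le> exp ((F + \<bar>l\<bar>) * p) * exp (l * t)" if "0 \<le> t" for t x
    using FK_one_le_total_mass[OF that, of x] that by (meson order_trans)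
  moreover have "1 \<le> exp ((F + \<bar>l\<bar>) * p)" using p_pos F_nonneg by simp
  ultimately show ?thesis using that by blast
qed

lemma FK_one_geometric_decay:
  assumes d_pos: "0 < d" and rate_neg: "rate Px X f < 0"
  obtains K q where "1 \<le> K" "0 < q" "q < 1" "\<And>k x. FK f (real k * d) (\<lambda>_. 1) x \<le> K * q ^ k"
proof -
  obtain l where l_between: "rate Px X f < l" "l < 0" using dense[OF rate_neg] by blast
  obtain K where K_growth: "1 \<le> K" "\<And>t x. 0 \<le> t \<Longrightarrow> FK f t (\<lambda>_. 1) x \<le> K * exp (l * t)"
    using FK_one_exponential_growth[OF l_between(1)] by blast
  show ?thesis
  proof (rule that[of K "exp (l * d)"])
    show "FK f (real k * d) (\<lambda>_. 1) x \<le> K * exp (l * d) ^ k" for k x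
      using K_growth(2)[of "real k * d" x] d_pos
      by (simp add: exp_of_nat_mult[symmetric] mult.left_commute)
  qed (use K_growth l_between d_pos in \<open>simp_all add: mult_neg_pos\<close>)
qed

lemma FK_le_FK_one:
  assumes t_nonneg: "0 \<le> t" and \<phi>_bounded: "\<phi> \<in> bounded_borel C"
  shows "FK f t \<phi> x \<le> C * FK f t (\<lambda>_. 1) x"
proof -
  have "(\<lambda>_. C * 1) \<in> bounded_borel C"
    using bounded_borelD(3)[OF \<phi>_bounded] by (simp add: bounded_borel_def)
  then have "FK f t \<phi> x \<le> FK f t (\<lambda>_. C * 1) x"
    using bounded_borelD(2)[OF \<phi>_bounded]
    by (intro FK_mono[OF t_nonneg \<phi>_bounded]) (auto simp: abs_le_iff)
  then show ?thesis by (simp only: FK_cmult)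
qed

lemma subsolution_iterate:
  assumes d_pos: "0 < d" and \<phi>_bounded: "\<phi> \<in> bounded_borel C"
    and subsolution: "\<And>x. \<phi> x \<le> 1 + FK f d \<phi> x"
  shows "\<phi> x \<le> (\<Sum>k<n. FK f (real k * d) (\<lambda>_. 1) x) + FK f (real n * d) \<phi> x"
proof (induction n)
  case 0
  then show ?case by (simp add: FK_0[OF \<phi>_bounded])
next
  case (Suc n)
  have nd_nonneg: "0 \<le> real n * d" and d_nonneg: "0 \<le> d" using d_pos by simp_all
  note FK_\<phi>_bounded = FK_bounded_borel[OF d_nonneg \<phi>_bounded]
  have "(\<lambda>z. 1 + FK f d \<phi> z) \<in> bounded_borel (1 + exp (F * d) * C)"
    using bounded_borelD[OF FK_\<phi>_bounded]
    by (auto simp: bounded_borel_def intro: order_trans[OF abs_triangle_ineq])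
  then have "FK f (real n * d) \<phi> x \<le> FK f (real n * d) (\<lambda>z. 1 + FK f d \<phi> z) x"
    by (intro FK_mono[OF nd_nonneg \<phi>_bounded] subsolution)
  also have "\<dots> = FK f (real n * d) (\<lambda>_. 1) x + FK f (real n * d + d) \<phi> x"
    by (simp add: FK_add[OF nd_nonneg one_bounded_borel FK_\<phi>_bounded]
      FK_semigroup[OF nd_nonneg d_nonneg \<phi>_bounded])
  also have "real n * d + d = real (Suc n) * d" by (simp add: algebra_simps)
  finally show ?case using Suc by simp
qed

theorem subsolution_uniformly_bounded:
  assumes d_pos: "0 < d" and rate_neg: "rate Px X f < 0"
  obtains Q where "1 \<le> Q"
    "\<And>\<phi> C x. \<phi> \<in> bounded_borel C \<Longrightarrow> (\<And>x. \<phi> x \<le> 1 + FK f d \<phi> x) \<Longrightarrow> \<phi> x \<le> Q"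
proof -
  obtain K q where K_ge_1: "1 \<le> K" and q_bounds: "0 < q" "q < 1"
    and decay: "\<And>k x. FK f (real k * d) (\<lambda>_. 1) x \<le> K * q ^ k"
    using FK_one_geometric_decay[OF d_pos rate_neg] by blast
  have "\<phi> x \<le> K / (1 - q)"
    if \<phi>_bounded: "\<phi> \<in> bounded_borel C" and subsolution: "\<And>x. \<phi> x \<le> 1 + FK f d \<phi> x" for \<phi> C x
  proof (rule LIMSEQ_le_const)
    have "(\<lambda>n. K / (1 - q) + C * (K * q ^ n)) \<longlonglongrightarrow> K / (1 - q) + C * (K * 0)"
      using q_bounds by (intro tendsto_intros LIMSEQ_power_zero) auto
    then show "(\<lambda>n. K / (1 - q) + C * (K * q ^ n)) \<longlonglongrightarrow> K / (1 - q)" by simp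
    have "\<phi> x \<le> K / (1 - q) + C * (K * q ^ n)" for n
    proof -
      have "(\<Sum>k<n. FK f (real k * d) (\<lambda>_. 1) x) \<le> (\<Sum>k<n. K * q ^ k)" by (intro sum_mono decay)
      also have "\<dots> = K * ((1 - q ^ n) / (1 - q))"
        using q_bounds by (simp add: sum_distrib_left[symmetric] sum_gp_strict)
      also have "\<dots> \<le> K * (1 / (1 - q))"
        using q_bounds K_ge_1 by (intro mult_left_mono divide_right_mono) auto
      finally have "(\<Sum>k<n. FK f (real k * d) (\<lambda>_. 1) x) \<le> K / (1 - q)" by simp
      moreover have "FK f (real n * d) \<phi> x \<le> C * (K * q ^ n)"
        using FK_le_FK_one[OF _ \<phi>_bounded, of "real n * d" x]
          mult_left_mono[OF decay bounded_borelD(3)[OF \<phi>_bounded], of n x] d_pos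
        by simp
      ultimately show ?thesis
        using subsolution_iterate[OF d_pos \<phi>_bounded subsolution, of x n] by linarith
    qed
    then show "\<exists>N. \<forall>n\<ge>N. \<phi> x \<le> K / (1 - q) + C * (K * q ^ n)" by blast
  qed
  moreover have "1 \<le> K / (1 - q)" using K_ge_1 q_bounds by (simp add: field_simps)
  ultimately show ?thesis using that by blast
qed

subsection \<open>Dyadic optimal stopping\<close>

context
  fixes d :: real
begin

definition adapted :: "('w \<Rightarrow> enat) \<Rightarrow> bool" where
  "adapted \<sigma> \<longleftrightarrow> (\<forall>k. {\<omega> \<in> space M. \<sigma> \<omega> = enat k} \<in> sets (past (real k * d)))"

definition payoff :: "('a \<Rightarrow> real) \<Rightarrow> nat \<Rightarrow> 'w \<Rightarrow> real" where
  "payoff \<theta> k \<omega> = exp (path_integral f 0 (real k * d) \<omega>) * \<theta> (X (real k * d) \<omega>)"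

definition stopped_payoff :: "('a \<Rightarrow> real) \<Rightarrow> ('w \<Rightarrow> enat) \<Rightarrow> nat \<Rightarrow> 'w \<Rightarrow> real" where
  "stopped_payoff \<theta> \<sigma> n \<omega> = payoff \<theta> (the_enat (min (\<sigma> \<omega>) (enat n))) \<omega>"

definition stopping_value :: "('a \<Rightarrow> real) \<Rightarrow> ('w \<Rightarrow> enat) \<Rightarrow> 'a \<Rightarrow> real" where
  "stopping_value G \<sigma> x = (\<integral>\<omega>. (case \<sigma> \<omega> of enat k \<Rightarrow> payoff G k \<omega> | \<infinity> \<Rightarrow> 0) \<partial>Px x)"

definition contact :: "('a \<Rightarrow> real) \<Rightarrow> ('a \<Rightarrow> real) \<Rightarrow> nat \<Rightarrow> 'w \<Rightarrow> bool" where
  "contact \<theta> G k \<omega> \<longleftrightarrow> \<theta> (X (real k * d) \<omega>) = G (X (real k * d) \<omega>)"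

definition contact_time :: "('a \<Rightarrow> real) \<Rightarrow> ('a \<Rightarrow> real) \<Rightarrow> nat \<Rightarrow> 'w \<Rightarrow> enat" where
  "contact_time \<theta> G n \<omega> = enat (LEAST k. k = n \<or> contact \<theta> G k \<omega>)"

context
  assumes d_pos: "0 < d"
begin

lemma grid_nonneg: "0 \<le> real k * d"
  using d_pos by simp

lemma dyadic_stopping_times_iff:
  "\<sigma> \<in> dyadic_stopping_times M Px X d x \<longleftrightarrow> adapted \<sigma> \<and> (\<exists>n. AE \<omega> in Px x. \<sigma> \<omega> \<le> enat n)"
  by (simp add: dyadic_stopping_times_def adapted_def)

lemma adapted_continue:
  assumes "adapted \<sigma>"
  shows "{\<omega> \<in> space M. enat k < \<sigma> \<omega>} \<in> sets (past (real k * d))"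
proof -
  have "{\<omega> \<in> space M. \<sigma> \<omega> = enat j} \<in> sets (past (real k * d))" if "j \<le> k" for j
  proof -
    have "real j * d \<le> real k * d" using that d_pos by simp
    from past_mono[OF this] show ?thesis
      using assms[unfolded adapted_def, rule_format, of j] by (rule subsetD)
  qed
  then have union_past: "(\<Union>j\<le>k. {\<omega> \<in> space M. \<sigma> \<omega> = enat j}) \<in> sets (past (real k * d))"
    by (intro sets.finite_UN) auto
  have less_iff_all_neq: "enat k < e \<longleftrightarrow> (\<forall>j\<le>k. e \<noteq> enat j)" for e
    by (cases e) (auto intro: leI)
  have "{\<omega> \<in> space M. enat k < \<sigma> \<omega>} =
      space (past (real k * d)) - (\<Union>j\<le>k. {\<omega> \<in> space M. \<sigma> \<omega> = enat j})"
    unfolding less_iff_all_neq by auto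
  with sets.compl_sets[OF union_past] show ?thesis by simp
qed

lemma payoff_0:
  assumes "\<theta> \<in> bounded_borel C"
  shows "(\<integral>\<omega>. payoff \<theta> 0 \<omega> \<partial>Px x) = \<theta> x"
  using FK_0[OF assms] by (simp add: payoff_def FK_def)

lemma expectation_payoff: "(\<integral>\<omega>. payoff \<theta> k \<omega> \<partial>Px x) = FK f (real k * d) \<theta> x"
  by (simp add: payoff_def FK_def)

lemma payoff_measurable:
  assumes "\<theta> \<in> bounded_borel C"
  shows "payoff \<theta> k \<in> borel_measurable M"
  using FK_integrand_measurable[OF order_refl grid_nonneg assms] by (simp add: payoff_def[abs_def])

lemma abs_payoff_le:
  assumes "\<theta> \<in> bounded_borel C" "\<omega> \<in> space M" "k \<le> n"
  shows "\<bar>payoff \<theta> k \<omega>\<bar> \<le> exp (F * (real n * d)) * C"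
proof -
  have "F * (real k * d) \<le> F * (real n * d)"
    using assms(3) d_pos F_nonneg by (intro mult_left_mono mult_right_mono) auto
  then have "exp (F * (real k * d)) * C \<le> exp (F * (real n * d)) * C"
    using bounded_borelD(3)[OF assms(1)] by (intro mult_right_mono) auto
  then show ?thesis
    using abs_FK_integrand_le[OF order_refl grid_nonneg assms(1,2), of k] by (simp add: payoff_def)
qed

lemma payoff_integrable:
  assumes "\<theta> \<in> bounded_borel C"
  shows "integrable (Px x) (payoff \<theta> k)"
  using payoff_measurable[OF assms] abs_payoff_le[OF assms _ order_refl]
  by (rule integrable_bounded)

lemma payoff_lower:
  assumes "0 \<le> a" "\<And>z. a \<le> G z" "\<omega> \<in> space M" "k \<le> n"
  shows "exp (- F * (real n * d)) * a \<le> payoff G k \<omega>"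
proof -
  have "F * (real k * d) \<le> F * (real n * d)"
    using assms(4) d_pos F_nonneg by (intro mult_left_mono mult_right_mono) auto
  then have "- F * (real n * d) \<le> path_integral f 0 (real k * d) \<omega>"
    using abs_path_integral_le[OF assms(3) order_refl grid_nonneg, of k] by simp
  then show ?thesis unfolding payoff_def using assms by (intro mult_mono) auto
qed

lemma payoff_nonneg: "(\<And>z. 0 \<le> \<theta> z) \<Longrightarrow> 0 \<le> payoff \<theta> k \<omega>"
  by (simp add: payoff_def)

lemma markov_payoff:
  assumes \<theta>_bounded: "\<theta> \<in> bounded_borel C" and E_past: "E \<in> sets (past (real k * d))"
  shows "(\<integral>\<omega>. indicator E \<omega> * payoff \<theta> (Suc k) \<omega> \<partial>Px x)
      = (\<integral>\<omega>. indicator E \<omega> * payoff (FK f d \<theta>) k \<omega> \<partial>Px x)"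
proof -
  let ?s = "real k * d"
  let ?Y = "\<lambda>\<omega>. indicator E \<omega> * exp (path_integral f 0 ?s \<omega>)"
  have d_nonneg: "0 \<le> d" using d_pos by simp
  note [measurable] = E_past path_integral_past_measurable[OF order_refl grid_nonneg, of k]
  have "payoff \<theta> (Suc k) \<omega> =
      exp (path_integral f 0 ?s \<omega>) * (exp (path_integral f ?s (?s + d) \<omega>) * \<theta> (X (?s + d) \<omega>))"
    if "\<omega> \<in> space M" for \<omega>
    using path_integral_combine[OF that grid_nonneg, of k "?s + d"] d_nonneg
    by (simp add: payoff_def exp_add distrib_right add.commute)
  then have "(\<integral>\<omega>. indicator E \<omega> * payoff \<theta> (Suc k) \<omega> \<partial>Px x) =
      (\<integral>\<omega>. ?Y \<omega> * (exp (path_integral f ?s (?s + d) \<omega>) * \<theta> (X (?s + d) \<omega>)) \<partial>Px x)"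
    by (intro Bochner_Integration.integral_cong) simp_all
  also have "\<dots> = (\<integral>\<omega>. ?Y \<omega> * FK f d \<theta> (X ?s \<omega>) \<partial>Px x)"
  proof (rule markov_FK[OF grid_nonneg d_nonneg _ _ \<theta>_bounded])
    show "\<bar>?Y \<omega>\<bar> \<le> exp (F * ?s)" if "\<omega> \<in> space M" for \<omega>
      using abs_path_integral_le[OF that order_refl grid_nonneg, of k]
      by (simp add: indicator_def abs_le_iff)
  qed measurable
  finally show ?thesis by (simp add: payoff_def mult.assoc)
qed

lemma stopped_payoff_0: "stopped_payoff \<theta> \<sigma> 0 = payoff \<theta> 0"
  using the_enat_min_le[of _ 0] by (simp add: fun_eq_iff stopped_payoff_def)

lemma stopped_payoff_Suc:
  "stopped_payoff \<theta> \<sigma> (Suc n) \<omega> = stopped_payoff \<theta> \<sigma> n \<omega> +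
    indicator {\<omega>. enat n < \<sigma> \<omega>} \<omega> * (payoff \<theta> (Suc n) \<omega> - payoff \<theta> n \<omega>)"
  by (cases "\<sigma> \<omega>") (auto simp: stopped_payoff_def indicator_def min_def le_Suc_eq)

lemma stopped_payoff_measurable:
  assumes "adapted \<sigma>" "\<theta> \<in> bounded_borel C"
  shows "stopped_payoff \<theta> \<sigma> n \<in> borel_measurable M"
proof (induction n)
  case 0
  then show ?case using payoff_measurable[OF assms(2)] by (simp add: stopped_payoff_0)
next
  case (Suc n)
  have [measurable]: "{\<omega> \<in> space M. enat n < \<sigma> \<omega>} \<in> sets M"
    using adapted_continue[OF assms(1), of n] past_subset by blast
  note [measurable] = Suc payoff_measurable[OF assms(2)]
  have "(\<lambda>\<omega>. stopped_payoff \<theta> \<sigma> n \<omega> +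
      indicator {\<omega> \<in> space M. enat n < \<sigma> \<omega>} \<omega> * (payoff \<theta> (Suc n) \<omega> - payoff \<theta> n \<omega>)) \<in>
        borel_measurable M"
    by measurable
  then show ?case
    by (rule measurable_cong[THEN iffD1, rotated]) (simp add: stopped_payoff_Suc indicator_def)
qed

lemma stopped_payoff_integrable:
  assumes "adapted \<sigma>" "\<theta> \<in> bounded_borel C"
  shows "integrable (Px x) (stopped_payoff \<theta> \<sigma> n)"
proof (rule integrable_bounded[OF stopped_payoff_measurable[OF assms]])
  show "\<bar>stopped_payoff \<theta> \<sigma> n \<omega>\<bar> \<le> exp (F * (real n * d)) * C" if "\<omega> \<in> space M" for \<omega>
    unfolding stopped_payoff_def by (rule abs_payoff_le[OF assms(2) that the_enat_min_le])
qed

lemma expectation_stopped_payoff_Suc: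
  assumes \<sigma>_adapted: "adapted \<sigma>" and \<theta>_bounded: "\<theta> \<in> bounded_borel C"
  shows "(\<integral>\<omega>. stopped_payoff \<theta> \<sigma> (Suc n) \<omega> \<partial>Px x) = (\<integral>\<omega>. stopped_payoff \<theta> \<sigma> n \<omega> \<partial>Px x) -
    (\<integral>\<omega>. indicator {\<omega> \<in> space M. enat n < \<sigma> \<omega>} \<omega> * (payoff \<theta> n \<omega> - payoff (FK f d \<theta>) n \<omega>) \<partial>Px x)"
proof -
  let ?E = "{\<omega> \<in> space M. enat n < \<sigma> \<omega>}"
  have E_sets: "?E \<in> sets (Px x)" using adapted_continue[OF \<sigma>_adapted, of n] past_subset by auto
  have FK_\<theta>_bounded: "FK f d \<theta> \<in> bounded_borel (exp (F * d) * C)"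
    using d_pos by (intro FK_bounded_borel \<theta>_bounded) simp
  have integrable: "integrable (Px x) (\<lambda>\<omega>. indicator ?E \<omega> * payoff \<theta>' k \<omega>)"
    if "\<theta>' \<in> bounded_borel C'" for \<theta>' C' k
    using integrable_real_mult_indicator[OF E_sets payoff_integrable[OF that]]
    by (simp add: mult.commute)
  have "(\<integral>\<omega>. stopped_payoff \<theta> \<sigma> (Suc n) \<omega> \<partial>Px x) = (\<integral>\<omega>. stopped_payoff \<theta> \<sigma> n \<omega> +
      (indicator ?E \<omega> * payoff \<theta> (Suc n) \<omega> - indicator ?E \<omega> * payoff \<theta> n \<omega>) \<partial>Px x)"
    by (intro Bochner_Integration.integral_cong) (auto simp: stopped_payoff_Suc indicator_def)
  also have "\<dots> = (\<integral>\<omega>. stopped_payoff \<theta> \<sigma> n \<omega> \<partial>Px x) +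
      ((\<integral>\<omega>. indicator ?E \<omega> * payoff \<theta> (Suc n) \<omega> \<partial>Px x) - (\<integral>\<omega>. indicator ?E \<omega> * payoff \<theta> n \<omega> \<partial>Px x))"
    by (simp add: stopped_payoff_integrable[OF \<sigma>_adapted \<theta>_bounded] integrable[OF \<theta>_bounded])
  also have "(\<integral>\<omega>. indicator ?E \<omega> * payoff \<theta> (Suc n) \<omega> \<partial>Px x)
      = (\<integral>\<omega>. indicator ?E \<omega> * payoff (FK f d \<theta>) n \<omega> \<partial>Px x)"
    by (rule markov_payoff[OF \<theta>_bounded adapted_continue[OF \<sigma>_adapted]])
  finally show ?thesis
    by (simp add: right_diff_distrib integrable[OF \<theta>_bounded] integrable[OF FK_\<theta>_bounded])
qed

lemma supermartingale_stopped_payoff: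
  assumes "adapted \<sigma>" "\<theta> \<in> bounded_borel C" and superharmonic: "\<And>z. FK f d \<theta> z \<le> \<theta> z"
  shows "(\<integral>\<omega>. stopped_payoff \<theta> \<sigma> n \<omega> \<partial>Px x) \<le> \<theta> x"
proof (induction n)
  case 0
  then show ?case by (simp add: stopped_payoff_0 payoff_0[OF assms(2)])
next
  case (Suc n)
  have "0 \<le> indicator {\<omega> \<in> space M. enat n < \<sigma> \<omega>} \<omega> * (payoff \<theta> n \<omega> - payoff (FK f d \<theta>) n \<omega>)" for \<omega>
    using superharmonic by (simp add: indicator_def payoff_def)
  then have "0 \<le> (\<integral>\<omega>. indicator {\<omega> \<in> space M. enat n < \<sigma> \<omega>} \<omega>
      * (payoff \<theta> n \<omega> - payoff (FK f d \<theta>) n \<omega>) \<partial>Px x)"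
    by (intro integral_nonneg_AE AE_I2)
  then show ?case using Suc unfolding expectation_stopped_payoff_Suc[OF assms(1,2)] by linarith
qed

lemma martingale_stopped_payoff:
  assumes "adapted \<sigma>" "\<theta> \<in> bounded_borel C"
    and harmonic_before: "\<And>\<omega> k. enat k < \<sigma> \<omega> \<Longrightarrow> FK f d \<theta> (X (real k * d) \<omega>) = \<theta> (X (real k * d) \<omega>)"
  shows "(\<integral>\<omega>. stopped_payoff \<theta> \<sigma> n \<omega> \<partial>Px x) = \<theta> x"
proof (induction n)
  case 0
  then show ?case by (simp add: stopped_payoff_0 payoff_0[OF assms(2)])
next
  case (Suc n)
  have "(\<integral>\<omega>. indicator {\<omega> \<in> space M. enat n < \<sigma> \<omega>} \<omega>
      * (payoff \<theta> n \<omega> - payoff (FK f d \<theta>) n \<omega>) \<partial>Px x) = 0"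
    using harmonic_before by (intro integral_eq_zero_AE AE_I2) (simp add: indicator_def payoff_def)
  then show ?case using Suc unfolding expectation_stopped_payoff_Suc[OF assms(1,2)] by simp
qed

lemma stopping_value_eq_expectation_stopped_payoff:
  assumes \<sigma>_adapted: "adapted \<sigma>" and \<sigma>_le: "AE \<omega> in Px x. \<sigma> \<omega> \<le> enat n"
    and G_bounded: "G \<in> bounded_borel C"
  shows "stopping_value G \<sigma> x = (\<integral>\<omega>. stopped_payoff G \<sigma> n \<omega> \<partial>Px x)"
  unfolding stopping_value_def
proof (rule integral_cong_AE)
  have "\<sigma> \<in> measurable M (count_space UNIV)"
    by (rule measurable_enatI,
      rule subsetD[OF past_subset \<sigma>_adapted[unfolded adapted_def, rule_format]])
  moreover have "(\<lambda>\<omega>. case e of enat k \<Rightarrow> payoff G k \<omega> | \<infinity> \<Rightarrow> 0) \<in> borel_measurable M" for e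
    by (cases e) (simp_all add: payoff_measurable[OF G_bounded])
  ultimately show "(\<lambda>\<omega>. case \<sigma> \<omega> of enat k \<Rightarrow> payoff G k \<omega> | \<infinity> \<Rightarrow> 0) \<in> borel_measurable (Px x)"
    unfolding measurable_Px
    by (rule measurable_compose_countable[rotated,
      where f = "\<lambda>e \<omega>. case e of enat k \<Rightarrow> payoff G k \<omega> | \<infinity> \<Rightarrow> 0"])
  show "stopped_payoff G \<sigma> n \<in> borel_measurable (Px x)"
    using stopped_payoff_measurable[OF \<sigma>_adapted G_bounded] by simp
  show "AE \<omega> in Px x. (case \<sigma> \<omega> of enat k \<Rightarrow> payoff G k \<omega> | \<infinity> \<Rightarrow> 0) = stopped_payoff G \<sigma> n \<omega>"
    using \<sigma>_le
  proof eventually_elim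
    case (elim \<omega>)
    then show ?case by (cases "\<sigma> \<omega>") (simp_all add: stopped_payoff_def min_def)
  qed
qed

lemma stopping_value_le:
  assumes \<sigma>_dyadic: "\<sigma> \<in> dyadic_stopping_times M Px X d x"
    and G_bounded: "G \<in> bounded_borel C" and \<theta>_bounded: "\<theta> \<in> bounded_borel C'"
    and "\<And>z. G z \<le> \<theta> z" and "\<And>z. FK f d \<theta> z \<le> \<theta> z"
  shows "stopping_value G \<sigma> x \<le> \<theta> x"
proof -
  obtain n where \<sigma>_le: "AE \<omega> in Px x. \<sigma> \<omega> \<le> enat n" and \<sigma>_adapted: "adapted \<sigma>"
    using \<sigma>_dyadic by (auto simp: dyadic_stopping_times_iff)
  have "stopping_value G \<sigma> x = (\<integral>\<omega>. stopped_payoff G \<sigma> n \<omega> \<partial>Px x)"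
    by (rule stopping_value_eq_expectation_stopped_payoff[OF \<sigma>_adapted \<sigma>_le G_bounded])
  also have "\<dots> \<le> (\<integral>\<omega>. stopped_payoff \<theta> \<sigma> n \<omega> \<partial>Px x)"
    using assms(4) by (intro integral_mono stopped_payoff_integrable[OF \<sigma>_adapted G_bounded]
        stopped_payoff_integrable[OF \<sigma>_adapted \<theta>_bounded]) (simp add: stopped_payoff_def payoff_def)
  also have "\<dots> \<le> \<theta> x" by (rule supermartingale_stopped_payoff[OF \<sigma>_adapted \<theta>_bounded assms(5)])
  finally show ?thesis .
qed

lemma stopping_value_pos:
  assumes \<sigma>_dyadic: "\<sigma> \<in> dyadic_stopping_times M Px X d x"
    and G_bounded: "G \<in> bounded_borel C" and a_lower: "0 < a" "\<And>z. a \<le> G z"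
  shows "0 < stopping_value G \<sigma> x"
proof -
  obtain n where \<sigma>_le: "AE \<omega> in Px x. \<sigma> \<omega> \<le> enat n" and \<sigma>_adapted: "adapted \<sigma>"
    using \<sigma>_dyadic by (auto simp: dyadic_stopping_times_iff)
  have "exp (- F * (real n * d)) * a \<le> stopped_payoff G \<sigma> n \<omega>" if "\<omega> \<in> space M" for \<omega>
    unfolding stopped_payoff_def using a_lower
    by (intro payoff_lower[OF _ _ that the_enat_min_le]) auto
  then have "exp (- F * (real n * d)) * a \<le> (\<integral>\<omega>. stopped_payoff G \<sigma> n \<omega> \<partial>Px x)"
    by (intro Px.integral_ge_const stopped_payoff_integrable[OF \<sigma>_adapted G_bounded] AE_I2) simp
  then show ?thesis
    using stopping_value_eq_expectation_stopped_payoff[OF \<sigma>_adapted \<sigma>_le G_bounded]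
      a_lower(1) less_le_trans[OF mult_pos_pos[OF exp_gt_zero]]
    by simp
qed

lemma contact_time_eq_iff:
  "contact_time \<theta> G n \<omega> = enat k \<longleftrightarrow>
    (k = n \<or> contact \<theta> G k \<omega>) \<and> (\<forall>j<k. \<not> (j = n \<or> contact \<theta> G j \<omega>))"
  unfolding contact_time_def enat.inject by (rule Least_eq_iff_first[of _ n]) simp

lemma contact_time_le: "contact_time \<theta> G n \<omega> \<le> enat n"
  by (simp add: contact_time_def Least_le)

lemma not_contact_before_contact_time:
  assumes "enat k < contact_time \<theta> G n \<omega>"
  shows "\<not> contact \<theta> G k \<omega>"
  using assms not_less_Least[of k "\<lambda>k. k = n \<or> contact \<theta> G k \<omega>"] by (simp add: contact_time_def)

lemma adapted_contact_time:
  assumes \<theta>_borel: "\<theta> \<in> borel_measurable borel" and G_borel: "G \<in> borel_measurable borel"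
  shows "adapted (contact_time \<theta> G n)"
  unfolding adapted_def
proof
  fix k
  define E where "E j = {\<omega> \<in> space (past (real k * d)). j = n \<or> contact \<theta> G j \<omega>}" for j
  have "E j \<in> sets (past (real k * d))" if "j \<le> k" for j
  proof -
    note [measurable] = \<theta>_borel G_borel
    have [measurable]: "X (real j * d) \<in> measurable (past (real k * d)) borel"
      using that d_pos by (intro X_past_measurable) (auto intro: mult_right_mono)
    show ?thesis unfolding E_def contact_def by measurable
  qed
  then have "E k - (\<Union>j<k. E j) \<in> sets (past (real k * d))"
    by (intro sets.Diff sets.finite_UN) simp_all
  also have "E k - (\<Union>j<k. E j) = {\<omega> \<in> space M. contact_time \<theta> G n \<omega> = enat k}"
    unfolding contact_time_eq_iff E_def space_past by blast
  finally show "{\<omega> \<in> space M. contact_time \<theta> G n \<omega> = enat k} \<in> sets (past (real k * d))" .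
qed

lemma stopped_payoff_contact_time_le:
  assumes "\<And>z. 0 \<le> \<theta> z" "\<And>z. 0 \<le> G z"
  shows "stopped_payoff \<theta> (contact_time \<theta> G n) n \<omega>
      \<le> stopped_payoff G (contact_time \<theta> G n) n \<omega> + payoff \<theta> n \<omega>"
proof -
  obtain k where contact_time_eq: "contact_time \<theta> G n \<omega> = enat k" by (simp add: contact_time_def)
  then have "min (contact_time \<theta> G n \<omega>) (enat n) = enat k"
    using contact_time_le[of \<theta> G n \<omega>] by (simp add: min_def)
  moreover have "k = n \<or> payoff \<theta> k \<omega> = payoff G k \<omega>"
    using contact_time_eq by (auto simp: contact_time_eq_iff contact_def payoff_def)
  ultimately show ?thesis
    using payoff_nonneg[of \<theta> n \<omega>, OF assms(1)] payoff_nonneg[of G k \<omega>, OF assms(2)]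
    by (auto simp: stopped_payoff_def)
qed

lemma contact_time_near_optimal:
  assumes G_bounded: "G \<in> bounded_borel C" "\<And>z. 0 \<le> G z"
    and \<theta>_bounded: "\<theta> \<in> bounded_borel C'" "\<And>z. 0 \<le> \<theta> z"
    and variational: "\<And>z. \<theta> z = max (FK f d \<theta> z) (G z)"
  shows "\<theta> x \<le> stopping_value G (contact_time \<theta> G n) x + FK f (real n * d) \<theta> x"
proof -
  let ?\<tau> = "contact_time \<theta> G n"
  have \<tau>_adapted: "adapted ?\<tau>"
    by (rule adapted_contact_time[OF bounded_borelD(1)[OF \<theta>_bounded(1)]
      bounded_borelD(1)[OF G_bounded(1)]])
  have "FK f d \<theta> (X (real k * d) \<omega>) = \<theta> (X (real k * d) \<omega>)" if "enat k < ?\<tau> \<omega>" for k \<omega>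
    using not_contact_before_contact_time[OF that] variational[of "X (real k * d) \<omega>"]
    by (simp add: contact_def max_def split: if_splits)
  then have "\<theta> x = (\<integral>\<omega>. stopped_payoff \<theta> ?\<tau> n \<omega> \<partial>Px x)"
    by (rule martingale_stopped_payoff[OF \<tau>_adapted \<theta>_bounded(1), symmetric])
  also have "\<dots> \<le> (\<integral>\<omega>. stopped_payoff G ?\<tau> n \<omega> + payoff \<theta> n \<omega> \<partial>Px x)"
    using stopped_payoff_contact_time_le[OF \<theta>_bounded(2) G_bounded(2)]
    by (intro integral_mono Bochner_Integration.integrable_add
      stopped_payoff_integrable[OF \<tau>_adapted G_bounded(1)]
        stopped_payoff_integrable[OF \<tau>_adapted \<theta>_bounded(1)] payoff_integrable[OF \<theta>_bounded(1)])
  also have "\<dots> = stopping_value G ?\<tau> x + FK f (real n * d) \<theta> x"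
    using stopping_value_eq_expectation_stopped_payoff[OF \<tau>_adapted AE_I2[OF contact_time_le]
      G_bounded(1)]
    by (simp add: stopped_payoff_integrable[OF \<tau>_adapted G_bounded(1)]
      payoff_integrable[OF \<theta>_bounded(1)] expectation_payoff)
  finally show ?thesis .
qed

lemma stopping_value_approximates:
  assumes rate_neg: "rate Px X f < 0"
    and G_bounded: "G \<in> bounded_borel C" "\<And>z. 0 \<le> G z"
    and \<theta>_bounded: "\<theta> \<in> bounded_borel C'" "\<And>z. 0 \<le> \<theta> z"
    and variational: "\<And>z. \<theta> z = max (FK f d \<theta> z) (G z)" and \<epsilon>_pos: "0 < \<epsilon>"
  obtains \<sigma> where "\<sigma> \<in> dyadic_stopping_times M Px X d x" "\<theta> x \<le> stopping_value G \<sigma> x + \<epsilon>"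
proof -
  obtain K q where q_bounds: "0 < q" "q < 1"
    and decay: "\<And>k x. FK f (real k * d) (\<lambda>_. 1) x \<le> K * q ^ k"
    using FK_one_geometric_decay[OF d_pos rate_neg] by metis
  have "(\<lambda>n. C' * (K * q ^ n)) \<longlonglongrightarrow> C' * (K * 0)"
    using q_bounds by (intro tendsto_intros LIMSEQ_power_zero) auto
  then have "\<forall>\<^sub>F n in sequentially. C' * (K * q ^ n) < \<epsilon>"
    using \<epsilon>_pos by (intro order_tendstoD(2)) auto
  then obtain n where n_large: "C' * (K * q ^ n) < \<epsilon>"
    using eventually_happens' sequentially_bot by blast
  have "FK f (real n * d) \<theta> x \<le> C' * FK f (real n * d) (\<lambda>_. 1) x"
    by (rule FK_le_FK_one[OF grid_nonneg \<theta>_bounded(1)])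
  also have "\<dots> \<le> C' * (K * q ^ n)"
    by (intro mult_left_mono decay bounded_borelD(3)[OF \<theta>_bounded(1)])
  finally have "\<theta> x \<le> stopping_value G (contact_time \<theta> G n) x + \<epsilon>"
    using contact_time_near_optimal[OF G_bounded \<theta>_bounded variational, of x n] n_large by simp
  moreover have "contact_time \<theta> G n \<in> dyadic_stopping_times M Px X d x"
    using adapted_contact_time[OF bounded_borelD(1)[OF \<theta>_bounded(1)]
      bounded_borelD(1)[OF G_bounded(1)]] contact_time_le
    unfolding dyadic_stopping_times_iff by (blast intro: AE_I2)
  ultimately show ?thesis using that by blast
qed

theorem ln_eq_SUP_stopping_value:
  assumes rate_neg: "rate Px X f < 0"
    and \<theta>_bounded: "\<theta> \<in> bounded_borel C'" and G_bounded: "G \<in> bounded_borel C"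
    and a_lower: "0 < a" "\<And>z. a \<le> G z"
    and variational: "\<And>z. \<theta> z = max (FK f d \<theta> z) (G z)"
  shows "ln (\<theta> x) = (SUP \<sigma>\<in>dyadic_stopping_times M Px X d x. ln (stopping_value G \<sigma> x))"
    (is "_ = (SUP \<sigma>\<in>?T. _)")
proof (rule cSup_eq_non_empty[symmetric])
  have \<theta>_ge: "G z \<le> \<theta> z" "FK f d \<theta> z \<le> \<theta> z" for z using variational[of z] by simp_all
  have G_pos: "0 < G z" for z using a_lower less_le_trans by blast
  then have \<theta>_pos: "0 < \<theta> z" for z using \<theta>_ge(1) less_le_trans by blast
  note value_pos = stopping_value_pos[OF _ G_bounded a_lower]
  note near_optimal = stopping_value_approximates[OF rate_neg G_bounded less_imp_le[OF G_pos]
    \<theta>_bounded less_imp_le[OF \<theta>_pos] variational]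
  show "(\<lambda>\<sigma>. ln (stopping_value G \<sigma> x)) ` ?T \<noteq> {}"
    using near_optimal[OF zero_less_one] by blast
  show "y \<le> ln (\<theta> x)" if "y \<in> (\<lambda>\<sigma>. ln (stopping_value G \<sigma> x)) ` ?T" for y
    using that value_pos stopping_value_le[OF _ G_bounded \<theta>_bounded \<theta>_ge] by (auto intro!: ln_mono)
  fix y assume y_upper: "\<And>z. z \<in> (\<lambda>\<sigma>. ln (stopping_value G \<sigma> x)) ` ?T \<Longrightarrow> z \<le> y"
  have "\<theta> x \<le> exp y + \<epsilon>" if \<epsilon>_pos: "0 < \<epsilon>" for \<epsilon>
  proof -
    obtain \<sigma> where \<sigma>_near: "\<sigma> \<in> ?T" "\<theta> x \<le> stopping_value G \<sigma> x + \<epsilon>"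
      by (rule near_optimal[OF \<epsilon>_pos])
    have "ln (stopping_value G \<sigma> x) \<le> y" using y_upper \<sigma>_near(1) by blast
    then have "stopping_value G \<sigma> x \<le> exp y"
      using value_pos[OF \<sigma>_near(1)] by (metis exp_le_cancel_iff exp_ln)
    then show ?thesis using \<sigma>_near(2) by simp
  qed
  then have "\<theta> x \<le> exp y" by (rule field_le_epsilon)
  then show "ln (\<theta> x) \<le> y" using \<theta>_pos by (metis exp_le_cancel_iff exp_ln)
qed

end

end

end

subsection \<open>Impulse control\<close>

locale impulse_control = feynman_kac M Px X f F
  for M :: "'w measure" and Px :: "'a::{metric_space, second_countable_topology} \<Rightarrow> 'w measure"
    and X :: "real \<Rightarrow> 'w \<Rightarrow> 'a" and f :: "'a \<Rightarrow> real" and F :: real +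
  fixes c :: "'a \<Rightarrow> 'a \<Rightarrow> real" and U :: "'a set" and H :: real and d :: real
  assumes U_compact: "compact U" and U_nonempty: "U \<noteq> {}"
    and c_continuous: "continuous_on (UNIV \<times> U) (\<lambda>(x, \<xi>). c x \<xi>)"
    and c_bounds: "\<And>x \<xi>. \<xi> \<in> U \<Longrightarrow> c x \<xi> \<in> {- H..0}"
    and d_pos: "0 < d"
begin

sublocale discounted: feynman_kac M Px X "\<lambda>x. f x - l" "F + \<bar>l\<bar>" for l
  by (rule feynman_kac_minus_const)

lemma bdd_above_cost:
  assumes "bdd_above (h ` U)"
  shows "bdd_above ((\<lambda>\<xi>. c x \<xi> + h \<xi>) ` U)"
proof -
  obtain b where "\<And>\<xi>. \<xi> \<in> U \<Longrightarrow> h \<xi> \<le> b" using assms by (auto simp: bdd_above_def)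
  then have "c x \<xi> + h \<xi> \<le> b" if "\<xi> \<in> U" for \<xi>
    using c_bounds[OF that, of x] that by fastforce
  then show ?thesis by (rule bdd_aboveI2)
qed

lemma Mop_bounds:
  assumes "bdd_above (h ` U)"
  shows "Mop c U h x \<in> {(SUP \<xi>\<in>U. h \<xi>) - H..(SUP \<xi>\<in>U. h \<xi>)}"
proof -
  have "c x \<xi> + h \<xi> \<le> (SUP \<xi>\<in>U. h \<xi>)" if "\<xi> \<in> U" for \<xi>
    using c_bounds[OF that, of x] cSUP_upper[OF that assms] by simp
  then have "Mop c U h x \<le> (SUP \<xi>\<in>U. h \<xi>)"
    unfolding Mop_def by (intro cSUP_least U_nonempty)
  moreover have "h \<xi> \<le> Mop c U h x + H" if "\<xi> \<in> U" for \<xi>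
    using c_bounds[OF that, of x] cSUP_upper[OF that bdd_above_cost[OF assms], of x]
    by (simp add: Mop_def)
  then have "(SUP \<xi>\<in>U. h \<xi>) \<le> Mop c U h x + H"
    by (intro cSUP_least U_nonempty)
  ultimately show ?thesis by simp
qed

lemma H_nonneg: "0 \<le> H"
proof -
  obtain \<xi> where "\<xi> \<in> U" using U_nonempty by blast
  from c_bounds[OF this, of undefined] show ?thesis by simp
qed

lemma Mop_minus_const:
  assumes "bdd_above (h ` U)"
  shows "Mop c U (\<lambda>\<xi>. h \<xi> - s) x = Mop c U h x - s"
  using Sup_add_eq[OF bdd_above_cost[OF assms] U_nonempty, of "- s" x]
  by (simp add: Mop_def algebra_simps)

lemma Mop_equicontinuous: "equicontinuous {h. bdd_above (h ` U)} (Mop c U)"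
  unfolding equicontinuous_def
proof (intro allI impI)
  fix x and \<epsilon> :: real assume "0 < \<epsilon>"
  then have half_pos: "0 < \<epsilon> / 2" by simp
  obtain S where "x \<in> S" "open S"
    "\<forall>y\<in>S \<inter> UNIV. \<forall>\<xi>\<in>U. dist ((\<lambda>(x, \<xi>). c x \<xi>) (y, \<xi>)) ((\<lambda>(x, \<xi>). c x \<xi>) (x, \<xi>)) \<le> \<epsilon> / 2"
    by (rule continuous_on_prod_compactE[OF c_continuous U_compact UNIV_I[of x] half_pos])
  then have "\<forall>\<^sub>F y in nhds x. \<forall>\<xi>\<in>U. \<bar>c y \<xi> - c x \<xi>\<bar> \<le> \<epsilon> / 2"
    unfolding eventually_nhds by (auto simp: dist_real_def intro!: exI[of _ S])
  then show "\<forall>\<^sub>F y in nhds x. \<forall>h\<in>{h. bdd_above (h ` U)}. dist (Mop c U h y) (Mop c U h x) < \<epsilon>"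
  proof eventually_elim
    case (elim y)
    have "\<bar>Mop c U h y - Mop c U h x\<bar> \<le> \<epsilon> / 2" if "bdd_above (h ` U)" for h
      unfolding Mop_def using elim by (intro abs_SUP_diff_le U_nonempty bdd_above_cost that) simp
    then show ?case using \<open>0 < \<epsilon>\<close> by (fastforce simp: dist_real_def)
  qed
qed

lemma Mop_tendsto:
  assumes "uniform_limit U v g G" "bdd_above (g ` U)"
  shows "((\<lambda>n. Mop c U (v n) x) \<longlongrightarrow> Mop c U g x) G"
  unfolding Mop_def
  using assms by (intro uniform_limit_SUP uniform_limit_add uniform_limit_const U_nonempty
    bdd_above_cost)

lemma bounded_borel_bdd_above: "h \<in> bounded_borel V \<Longrightarrow> bdd_above (h ` U)"
  using bounded_borelD(2)[of h V] by (intro bdd_aboveI2[of _ _ V]) (simp add: abs_le_iff)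

lemma abs_Mop_le:
  assumes "\<And>\<xi>. \<xi> \<in> U \<Longrightarrow> \<bar>h \<xi>\<bar> \<le> V"
  shows "\<bar>Mop c U h x\<bar> \<le> V + H"
proof -
  have "bdd_above (h ` U)" using assms by (intro bdd_aboveI2[of _ _ V]) (simp add: abs_le_iff)
  from Mop_bounds[OF this, of x]
  have "(SUP \<xi>\<in>U. h \<xi>) - H \<le> Mop c U h x" "Mop c U h x \<le> (SUP \<xi>\<in>U. h \<xi>)"
    by simp_all
  moreover have "\<bar>SUP \<xi>\<in>U. h \<xi>\<bar> \<le> V"
    by (rule cSup_abs_le) (use U_nonempty assms in auto)
  ultimately show ?thesis using H_nonneg by linarith
qed

lemma Mop_bounded_borel:
  assumes "h \<in> bounded_borel V"
  shows "Mop c U h \<in> bounded_borel (V + H)"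
proof -
  have "continuous_on UNIV (Mop c U h)"
    using bounded_borel_bdd_above[OF assms]
    by (intro equicontinuous_imp_continuous_on[OF Mop_equicontinuous]) simp
  then show ?thesis
    using abs_Mop_le[OF bounded_borelD(2)[OF assms]]
    by (simp add: bounded_borel_def borel_measurable_continuous_onI)
qed

definition bellman :: "real \<Rightarrow> ('a \<Rightarrow> real) \<Rightarrow> 'a \<Rightarrow> real" where
  "bellman l w x = max (ln (FK (\<lambda>x. f x - l) d (\<lambda>z. exp (w z)) x)) (Mop c U w x)"

lemma FK_exp_pos:
  assumes "w \<in> bounded_borel V"
  shows "0 < FK (\<lambda>x. f x - l) d (\<lambda>z. exp (w z)) x"
  using discounted.FK_exp_lower[OF less_imp_le[OF d_pos] assms] less_le_trans[OF exp_gt_zero]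
  by blast

lemma bellman_eq:
  assumes "w \<in> bounded_borel V"
  shows "bellman l w x = max (ln (FK f d (\<lambda>z. exp (w z)) x) - l * d) (Mop c U w x)"
proof -
  have "0 < FK f d (\<lambda>z. exp (w z)) x" using FK_exp_pos[OF assms, of 0] by simp
  then show ?thesis
    using d_pos by (simp add: bellman_def FK_minus_const ln_mult_pos)
qed

lemma exp_bellman:
  assumes "w \<in> bounded_borel V"
  shows "exp (bellman l w x) = max (FK (\<lambda>x. f x - l) d (\<lambda>z. exp (w z)) x) (exp (Mop c U w x))"
proof -
  have "exp (max a b) = max (exp a) (exp b)" for a b :: real by (simp add: max_def)
  then show ?thesis using FK_exp_pos[OF assms] by (simp add: bellman_def)
qed

lemma bellman_equicontinuous: "equicontinuous (UNIV \<times> bounded_borel V) (\<lambda>(l, w). bellman l w)"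
proof -
  have FK_exp_range: "FK f d (\<lambda>z. exp (w z)) x \<in> {exp (- (F * d + V))..}"
    if "w \<in> bounded_borel V" for w x
    using FK_exp_lower[OF less_imp_le[OF d_pos] that] by simp
  have "equicontinuous (bounded_borel V) (\<lambda>w. FK f d (\<lambda>z. exp (w z)))"
    by (rule equicontinuous_reindex[OF FK_equicontinuous[OF d_pos]]) (auto intro: exp_bounded_borel)
  then have "equicontinuous (bounded_borel V) (\<lambda>w x. ln (FK f d (\<lambda>z. exp (w z)) x))"
    by (rule equicontinuous_uniformly_continuous_compose[OF _ uniformly_continuous_on_ln_atLeast])
      (use FK_exp_range in auto)
  then have "equicontinuous (UNIV \<times> bounded_borel V) (\<lambda>p x. ln (FK f d (\<lambda>z. exp (snd p z)) x)
      - fst p * d)"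
    by (fastforce simp: equicontinuous_def dist_real_def elim!: eventually_mono)
  moreover have "equicontinuous (UNIV \<times> bounded_borel V) (\<lambda>p. Mop c U (snd p))"
    by (rule equicontinuous_reindex[OF Mop_equicontinuous]) (auto intro: bounded_borel_bdd_above)
  ultimately have "equicontinuous (UNIV \<times> bounded_borel V)
      (\<lambda>p x. max (ln (FK f d (\<lambda>z. exp (snd p z)) x) - fst p * d) (Mop c U (snd p) x))"
    by (rule equicontinuous_max)
  then show ?thesis
    by (fastforce simp: equicontinuous_def bellman_eq elim!: eventually_mono)
qed

lemma abs_bellman_le:
  assumes w_bounded: "w \<in> bounded_borel V"
  shows "\<bar>bellman l w x\<bar> \<le> (F + \<bar>l\<bar>) * d + V + H"
proof -
  let ?E = "FK (\<lambda>x. f x - l) d (\<lambda>z. exp (w z)) x"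
  have "exp (- ((F + \<bar>l\<bar>) * d + V)) \<le> ?E"
    by (rule discounted.FK_exp_lower[OF less_imp_le[OF d_pos] w_bounded])
  then have "- ((F + \<bar>l\<bar>) * d + V) \<le> ln ?E"
    using FK_exp_pos[OF w_bounded] by (simp only: ln_ge_iff)
  moreover have "?E \<le> exp ((F + \<bar>l\<bar>) * d + V)"
    using bounded_borelD(2)[OF discounted.FK_bounded_borel[OF less_imp_le[OF d_pos]
      exp_bounded_borel[OF w_bounded]]]
    by (simp add: abs_le_iff exp_add)
  then have "ln ?E \<le> ln (exp ((F + \<bar>l\<bar>) * d + V))"
    using FK_exp_pos[OF w_bounded] by (intro ln_mono) auto
  ultimately have "\<bar>ln ?E\<bar> \<le> (F + \<bar>l\<bar>) * d + V" unfolding ln_exp by linarith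
  moreover have "\<bar>Mop c U w x\<bar> \<le> V + H"
    by (rule bounded_borelD(2)[OF Mop_bounded_borel[OF w_bounded]])
  moreover have "0 \<le> (F + \<bar>l\<bar>) * d" using F_nonneg d_pos by simp
  ultimately show ?thesis using H_nonneg by (simp add: bellman_def abs_le_iff max_def)
qed

lemma bellman_tendsto:
  assumes w_bounded: "\<And>n. w n \<in> bounded_borel V" and g_bounded: "g \<in> bounded_borel V"
    and pointwise: "\<And>x. (\<lambda>n. w n x) \<longlonglongrightarrow> g x" and uniform: "uniform_limit U w g sequentially"
    and lam_tendsto: "lam \<longlonglongrightarrow> l"
  shows "(\<lambda>n. bellman (lam n) (w n) x) \<longlonglongrightarrow> bellman l g x"
proof -
  have "(\<lambda>n. FK f d (\<lambda>z. exp (w n z)) x) \<longlonglongrightarrow> FK f d (\<lambda>z. exp (g z)) x"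
    by (intro FK_tendsto[OF less_imp_le[OF d_pos] exp_bounded_borel[OF w_bounded]] tendsto_exp
      pointwise)
  moreover have "FK f d (\<lambda>z. exp (g z)) x \<noteq> 0"
    using FK_exp_pos[OF g_bounded, of 0 x] by simp
  ultimately show ?thesis
    unfolding bellman_eq[OF w_bounded] bellman_eq[OF g_bounded]
    by (intro tendsto_max tendsto_diff tendsto_ln tendsto_mult tendsto_const lam_tendsto
        Mop_tendsto[OF uniform bounded_borel_bdd_above[OF g_bounded]])
qed

abbreviation OS :: "'a set \<Rightarrow> real \<Rightarrow> ('a \<Rightarrow> real) \<Rightarrow> bool" where
  "OS B l w \<equiv> OS_solution Px X f c U d B l w"

lemma OS_solution_iff_bellman:
  "OS B l w \<longleftrightarrow> bounded (w ` B) \<and> continuous_on B w \<and>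
    (\<forall>x. x \<notin> B \<longrightarrow> w x = Mop c U w x) \<and> (\<forall>x\<in>B. w x = bellman l w x)"
proof -
  have "(\<integral>\<omega>. exp (integral {0..d} (\<lambda>s. f (X s \<omega>) - l) +
        (if X d \<omega> \<in> B then w (X d \<omega>) else Mop c U w (X d \<omega>))) \<partial>Px x) =
      FK (\<lambda>x. f x - l) d (\<lambda>z. exp (w z)) x"
    if off_B: "\<forall>x. x \<notin> B \<longrightarrow> w x = Mop c U w x" for x
  proof -
    have "(if z \<in> B then w z else Mop c U w z) = w z" for z using off_B by simp
    then show ?thesis by (simp add: FK_def path_integral_def exp_add)
  qed
  then show ?thesis unfolding OS_solution_def bellman_def by auto
qed

lemma OS_solutionD:
  assumes "OS B l w"
  shows "bounded (w ` B)" "continuous_on B w" "x \<notin> B \<Longrightarrow> w x = Mop c U w x"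
    "x \<in> B \<Longrightarrow> w x = bellman l w x"
  using assms unfolding OS_solution_iff_bellman by blast+

lemma OS_solution_bounded_borel:
  assumes B_sets: "closed B" "U \<subseteq> B" and solution: "OS B l w"
  obtains V where "w \<in> bounded_borel V"
proof -
  obtain V where w_le_on_B: "\<And>x. x \<in> B \<Longrightarrow> \<bar>w x\<bar> \<le> V"
    using OS_solutionD(1)[OF solution] by (auto simp: bounded_iff)
  then have w_le_on_U: "\<bar>w \<xi>\<bar> \<le> V" if "\<xi> \<in> U" for \<xi> using B_sets(2) that by blast
  have w_bdd_above: "bdd_above (w ` U)"
    by (rule bdd_aboveI2[of _ _ V]) (use w_le_on_U in \<open>simp add: abs_le_iff\<close>)
  have "continuous_on (- B) (Mop c U w)"
    by (rule equicontinuous_imp_continuous_on[OF Mop_equicontinuous]) (simp add: w_bdd_above)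
  then have "(\<lambda>x. if x \<in> B then w x else Mop c U w x) \<in> borel_measurable borel"
    using B_sets(1) OS_solutionD(2)[OF solution]
    by (intro borel_measurable_continuous_on_if) (auto intro: borel_closed)
  also have "(\<lambda>x. if x \<in> B then w x else Mop c U w x) = w"
    using OS_solutionD(3)[OF solution] by auto
  finally have "w \<in> borel_measurable borel" .
  moreover have "\<bar>w x\<bar> \<le> V + H" for x
  proof (cases "x \<in> B")
    case True
    then show ?thesis using w_le_on_B H_nonneg by fastforce
  next
    case False
    then show ?thesis using abs_Mop_le[OF w_le_on_U] OS_solutionD(3)[OF solution] by simp
  qed
  ultimately show ?thesis using that by (auto simp: bounded_borel_def)
qed

lemma OS_solution_minus_const:
  assumes solution: "OS B l w" and w_bounded: "w \<in> bounded_borel V"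
  shows "OS B l (\<lambda>x. w x - s)"
proof -
  have Mop_shift: "Mop c U (\<lambda>x. w x - s) x = Mop c U w x - s" for x
    by (rule Mop_minus_const[OF bounded_borel_bdd_above[OF w_bounded]])
  have "(\<lambda>z. exp (w z - s)) = (\<lambda>z. exp (- s) * exp (w z))"
    by (simp add: exp_diff exp_minus field_simps)
  then have "ln (FK (\<lambda>x. f x - l) d (\<lambda>z. exp (w z - s)) x)
      = ln (FK (\<lambda>x. f x - l) d (\<lambda>z. exp (w z)) x) - s" for x
    using FK_exp_pos[OF w_bounded] by (simp add: discounted.FK_cmult ln_mult_pos)
  then have "bellman l (\<lambda>x. w x - s) x = bellman l w x - s" for x
    by (simp add: bellman_def Mop_shift max_diff_distrib_left)
  moreover have "bounded ((\<lambda>x. w x - s) ` B)"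
    using bounded_borelD(2)[OF w_bounded]
    by (auto simp: bounded_iff intro!: exI[of _ "V + \<bar>s\<bar>"] order_trans[OF abs_triangle_ineq4])
  ultimately show ?thesis
    using solution by (auto simp: OS_solution_iff_bellman Mop_shift intro!: continuous_intros)
qed

lemma OS_solution_normalise:
  assumes B_sets: "closed B" "U \<subseteq> B" and solution: "OS B l w"
  obtains v where "OS B l v" "(SUP \<xi>\<in>U. v \<xi>) = 0"
proof -
  obtain V where w_bounded: "w \<in> bounded_borel V"
    by (rule OS_solution_bounded_borel[OF B_sets solution])
  define s where "s = (SUP \<xi>\<in>U. w \<xi>)"
  have "(SUP \<xi>\<in>U. w \<xi> - s) = 0"
    using Sup_add_eq[OF bounded_borel_bdd_above[OF w_bounded] U_nonempty, of "- s"]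
    by (simp add: s_def)
  then show ?thesis by (rule that[OF OS_solution_minus_const[OF solution w_bounded]])
qed

lemma FK_discount_mono:
  assumes "l \<le> l'" "\<phi> \<in> bounded_borel C" "\<And>z. 0 \<le> \<phi> z"
  shows "FK (\<lambda>x. f x - l') d \<phi> x \<le> FK (\<lambda>x. f x - l) d \<phi> x"
  using assms d_pos FK_lower[OF less_imp_le[OF d_pos] assms(2) order_refl assms(3)]
  by (simp add: FK_minus_const) (intro mult_right_mono, auto)

lemma OS_solution_cases:
  assumes "OS B l w"
  shows "w x = Mop c U w x \<or> w x = bellman l w x"
  using OS_solutionD(3,4)[OF assms] by blast

lemma exp_OS_solution_subsolution:
  assumes l_le: "l \<le> l'" and solution: "OS B l' v" and v_bounded: "v \<in> bounded_borel C"
    and SUP_zero: "(SUP \<xi>\<in>U. v \<xi>) = 0"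
  shows "exp (v x) \<le> 1 + FK (\<lambda>x. f x - l) d (\<lambda>z. exp (v z)) x"
proof -
  have "exp (v x) \<le> max (FK (\<lambda>x. f x - l') d (\<lambda>z. exp (v z)) x) (exp (Mop c U v x))"
    using OS_solution_cases[OF solution, of x] exp_bellman[OF v_bounded, of l' x] by auto
  also have "\<dots> \<le> max (FK (\<lambda>x. f x - l) d (\<lambda>z. exp (v z)) x) 1"
    using FK_discount_mono[OF l_le exp_bounded_borel[OF v_bounded]] SUP_zero
      Mop_bounds[OF bounded_borel_bdd_above[OF v_bounded], of x] by (intro max.mono) auto
  also have "\<dots> \<le> 1 + FK (\<lambda>x. f x - l) d (\<lambda>z. exp (v z)) x"
    using FK_exp_pos[OF v_bounded, of l x] by simp
  finally show ?thesis .
qed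

theorem OS_solution_uniformly_bounded:
  assumes rate_less: "rate Px X f < l"
  obtains V where "\<And>B l' v. \<lbrakk>closed B; U \<subseteq> B; l \<le> l'; OS B l' v; (SUP \<xi>\<in>U. v \<xi>) = 0\<rbrakk> \<Longrightarrow>
    v \<in> bounded_borel V"
proof -
  have "rate Px X (\<lambda>x. f x - l) < 0" using rate_less by (simp add: rate_minus_const)
  then obtain Q where Q_ge_1: "1 \<le> Q" and le_Q: "\<And>\<phi> C x. \<phi> \<in> bounded_borel C \<Longrightarrow>
      (\<And>x. \<phi> x \<le> 1 + FK (\<lambda>x. f x - l) d \<phi> x) \<Longrightarrow> \<phi> x \<le> Q"
    using discounted.subsolution_uniformly_bounded[OF d_pos] by blast
  have "v \<in> bounded_borel (ln Q + H)"
    if B_sets: "closed B" "U \<subseteq> B" and l_le: "l \<le> l'" and solution: "OS B l' v"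
      and SUP_zero: "(SUP \<xi>\<in>U. v \<xi>) = 0" for B l' v
  proof -
    obtain C where v_bounded: "v \<in> bounded_borel C"
      by (rule OS_solution_bounded_borel[OF B_sets solution])
    have "exp (v x) \<le> Q" for x
      by (rule le_Q[OF exp_bounded_borel[OF v_bounded]
          exp_OS_solution_subsolution[OF l_le solution v_bounded SUP_zero]])
    then have v_le: "v x \<le> ln Q" for x using Q_ge_1 by (simp add: ln_ge_iff)
    have "- H \<le> Mop c U v x" for x
      using Mop_bounds[OF bounded_borel_bdd_above[OF v_bounded], of x] SUP_zero by simp
    then have v_ge: "- H \<le> v x" for x
      using OS_solution_cases[OF solution, of x] by (auto simp: bellman_def le_max_iff_disj)
    have "0 \<le> ln Q" using Q_ge_1 by simp
    then have "\<bar>v x\<bar> \<le> ln Q + H" for x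
      unfolding abs_le_iff using v_le[of x] v_ge[of x] H_nonneg by linarith
    then show ?thesis using bounded_borelD(1)[OF v_bounded] by (simp add: bounded_borel_def)
  qed
  then show ?thesis using that by blast
qed

lemma bellman_convergent_subsequence:
  assumes v_bounded: "\<And>n::nat. v n \<in> bounded_borel V" and lam_tendsto: "lam \<longlonglongrightarrow> l"
  obtains r g where "strict_mono r" "continuous_on UNIV g"
    "\<And>x. (\<lambda>n. bellman (lam (r n)) (v (r n)) x) \<longlonglongrightarrow> g x"
    "\<And>K. compact K \<Longrightarrow> uniform_limit K (\<lambda>n. bellman (lam (r n)) (v (r n))) g sequentially"
proof -
  obtain S where lam_bounded: "\<And>n. \<bar>lam n\<bar> \<le> S"
    using convergent_imp_Bseq[OF convergentI[OF lam_tendsto]] unfolding Bseq_def real_norm_def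
    by blast
  have bounded: "norm (bellman (lam n) (v n) x) \<le> (F + S) * d + V + H" for n x
  proof -
    have "(F + \<bar>lam n\<bar>) * d \<le> (F + S) * d"
      using lam_bounded[of n] d_pos by (intro mult_right_mono) auto
    then show ?thesis using abs_bellman_le[OF v_bounded, of "lam n" n x] by simp
  qed
  have equicontinuous: "equicontinuous UNIV (\<lambda>n. bellman (lam n) (v n))"
    using equicontinuous_reindex[OF bellman_equicontinuous, of "\<lambda>n. (lam n, v n)" UNIV V] v_bounded
    by auto
  show ?thesis by (rule Arzela_Ascoli_locally_uniform[OF equicontinuous bounded that])
qed

lemma OS_subsequence_limit:
  assumes exhaustion: "\<And>n. U \<subseteq> B n" "\<And>x. \<forall>\<^sub>F n in sequentially. x \<in> B n"
    and solution: "\<And>n. OS (B n) (lam n) (v n)" and v_bounded: "\<And>n. v n \<in> bounded_borel V"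
    and lam_tendsto: "lam \<longlonglongrightarrow> l"
  obtains r g where "strict_mono r" "g \<in> bounded_borel V"
    "uniform_limit U (\<lambda>n. v (r n)) g sequentially" "OS UNIV l g"
proof -
  have bellman_eq_v: "bellman (lam n) (v n) x = v n x" if "x \<in> B n" for n x
    using OS_solutionD(4)[OF solution that] by simp
  obtain r g where r_mono: "strict_mono r" and g_continuous: "continuous_on UNIV g"
    and pointwise: "\<And>x. (\<lambda>n. bellman (lam (r n)) (v (r n)) x) \<longlonglongrightarrow> g x"
    and uniform: "\<And>K. compact K \<Longrightarrow>
        uniform_limit K (\<lambda>n. bellman (lam (r n)) (v (r n))) g sequentially"
    by (rule bellman_convergent_subsequence[of v V lam l, OF v_bounded lam_tendsto]) blast
  have v_pointwise: "(\<lambda>n. v (r n) x) \<longlonglongrightarrow> g x" for x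
  proof (rule Lim_transform_eventually[OF pointwise])
    have "\<forall>\<^sub>F n in sequentially. x \<in> B (r n)"
      using exhaustion(2) filterlim_subseq[OF r_mono] by (rule eventually_compose_filterlim)
    then show "\<forall>\<^sub>F n in sequentially. bellman (lam (r n)) (v (r n)) x = v (r n) x"
      by (rule eventually_mono) (rule bellman_eq_v)
  qed
  have "bellman (lam (r n)) (v (r n)) \<xi> = v (r n) \<xi>" if "\<xi> \<in> U" for n \<xi>
    using bellman_eq_v exhaustion(1) that by blast
  then have v_uniform: "uniform_limit U (\<lambda>n. v (r n)) g sequentially"
    using uniform[OF U_compact] by (simp cong: uniform_limit_cong')
  have "\<bar>g x\<bar> \<le> V" for x
    by (rule LIMSEQ_le_const2[OF tendsto_rabs[OF v_pointwise]])
      (use bounded_borelD(2)[OF v_bounded] in blast)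
  then have g_bounded: "g \<in> bounded_borel V"
    using borel_measurable_continuous_onI[OF g_continuous] by (simp add: bounded_borel_def)
  have "(\<lambda>n. lam (r n)) \<longlonglongrightarrow> l"
    using LIMSEQ_subseq_LIMSEQ[OF lam_tendsto r_mono] by (simp add: comp_def)
  then have "(\<lambda>n. bellman (lam (r n)) (v (r n)) x) \<longlonglongrightarrow> bellman l g x" for x
    by (rule bellman_tendsto[OF v_bounded g_bounded v_pointwise v_uniform])
  then have "g x = bellman l g x" for x by (rule LIMSEQ_unique[OF pointwise])
  then have "OS UNIV l g"
    unfolding OS_solution_iff_bellman
    using g_continuous bounded_borelD(2)[OF g_bounded] by (auto simp: bounded_iff)
  then show ?thesis by (rule that[OF r_mono g_bounded v_uniform])
qed

theorem OS_limit:
  assumes exhaustion: "\<And>m. compact (B m)" "U \<subseteq> B 0" "\<And>m. B m \<subseteq> B (Suc m)" "(\<Union>m. B m) = UNIV"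
    and solution: "\<And>m. OS (B m) (lam m) (w m)"
    and lam_tendsto: "lam \<longlonglongrightarrow> l" and rate_less: "rate Px X f < l"
  obtains g where "OS UNIV l g" "(SUP \<xi>\<in>U. g \<xi>) = 0"
proof -
  have B_mono: "B m \<subseteq> B n" if "m \<le> n" for m n using exhaustion(3) that by (rule lift_Suc_mono_le)
  have B_closed: "closed (B m)" and U_subset: "U \<subseteq> B m" for m
    using exhaustion(1,2) B_mono[of 0 m] by (auto intro: compact_imp_closed)
  obtain l0 where l0_between: "rate Px X f < l0" "l0 < l" using dense[OF rate_less] by blast
  obtain V where uniform_bound: "\<And>B l' v. closed B \<Longrightarrow> U \<subseteq> B \<Longrightarrow> l0 \<le> l' \<Longrightarrow> OS B l' v \<Longrightarrow>
      (SUP \<xi>\<in>U. v \<xi>) = 0 \<Longrightarrow> v \<in> bounded_borel V"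
    using OS_solution_uniformly_bounded[OF l0_between(1)] by blast
  have "\<exists>v. OS (B m) (lam m) v \<and> (SUP \<xi>\<in>U. v \<xi>) = 0" for m
    by (rule OS_solution_normalise[OF B_closed U_subset solution]) blast
  then obtain v where v_normalised: "\<And>m. OS (B m) (lam m) (v m)" "\<And>m. (SUP \<xi>\<in>U. v m \<xi>) = 0" by metis
  obtain m0 where lam_large: "\<And>m. m0 \<le> m \<Longrightarrow> l0 < lam m"
    using order_tendstoD(1)[OF lam_tendsto l0_between(2)] unfolding eventually_sequentially by blast
  have eventually_B: "\<forall>\<^sub>F n in sequentially. x \<in> B (n + m0)" for x
  proof -
    obtain j where "x \<in> B j" using exhaustion(4) by blast
    then have "x \<in> B (n + m0)" if "j \<le> n" for n using B_mono[of j "n + m0"] that by auto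
    then show ?thesis by (rule eventually_sequentiallyI)
  qed
  obtain r g where "strict_mono r" and g_limit: "g \<in> bounded_borel V"
    "uniform_limit U (\<lambda>n. v (r n + m0)) g sequentially" "OS UNIV l g"
  proof (rule OS_subsequence_limit[where B = "\<lambda>n. B (n + m0)" and v = "\<lambda>n. v (n + m0)",
    OF U_subset eventually_B v_normalised(1)])
    show "v (n + m0) \<in> bounded_borel V" for n
      using lam_large[of "n + m0"]
      by (intro uniform_bound[OF B_closed U_subset _ v_normalised]) simp
    show "(\<lambda>n. lam (n + m0)) \<longlonglongrightarrow> l" by (rule LIMSEQ_ignore_initial_segment[OF lam_tendsto])
  qed
  have "(SUP \<xi>\<in>U. g \<xi>) = 0"
    using uniform_limit_SUP[OF g_limit(2) U_nonempty bounded_borel_bdd_above[OF g_limit(1)]]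
    by (simp add: v_normalised(2) LIMSEQ_const_iff)
  with g_limit(3) show ?thesis by (rule that)
qed

theorem OS_verification:
  assumes solution: "OS UNIV l g" and rate_less: "rate Px X f < l"
  shows "g x = (SUP \<sigma>\<in>dyadic_stopping_times M Px X d x.
    ln (\<integral>\<omega>. (case \<sigma> \<omega> of
        enat k \<Rightarrow> exp (integral {0..real k * d} (\<lambda>s. f (X s \<omega>) - l) + Mop c U g (X (real k * d) \<omega>))
      | \<infinity> \<Rightarrow> 0) \<partial>Px x))"
proof -
  obtain V where g_bounded: "g \<in> bounded_borel V"
    by (rule OS_solution_bounded_borel[OF closed_UNIV subset_UNIV solution])
  note Mop_bounded = Mop_bounded_borel[OF g_bounded]
  have "g z = bellman l g z" for z by (rule OS_solutionD(4)[OF solution UNIV_I])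
  then have variational: "exp (g z)
      = max (FK (\<lambda>x. f x - l) d (\<lambda>z. exp (g z)) z) (exp (Mop c U g z))" for z
    using exp_bellman[OF g_bounded] by metis
  have "rate Px X (\<lambda>x. f x - l) < 0" using rate_less by (simp add: rate_minus_const)
  then have "ln (exp (g x)) = (SUP \<sigma>\<in>dyadic_stopping_times M Px X d x.
      ln (discounted.stopping_value l d (\<lambda>z. exp (Mop c U g z)) \<sigma> x))"
  proof (rule discounted.ln_eq_SUP_stopping_value[OF d_pos _ exp_bounded_borel[OF g_bounded]
    exp_bounded_borel[OF Mop_bounded] _ _ variational])
    show "exp (- (V + H)) \<le> exp (Mop c U g z)" for z
      using bounded_borelD(2)[OF Mop_bounded, of z]
      by (simp only: exp_le_cancel_iff abs_le_iff minus_le_iff)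
  qed simp
  then show ?thesis
    by (simp add: discounted.stopping_value_def discounted.payoff_def path_integral_def
        exp_add d_pos cong: enat.case_cong)
qed

end

theorem theorem4p2:
  fixes M :: "'w measure" and Px :: "'a::{metric_space, second_countable_topology} \<Rightarrow> 'w measure"
    and X :: "real \<Rightarrow> 'w \<Rightarrow> 'a"
    and f :: "'a \<Rightarrow> real" and c :: "'a \<Rightarrow> 'a \<Rightarrow> real" and U :: "'a set"
    and B :: "nat \<Rightarrow> 'a set" and \<delta> :: real
    and lam :: "nat \<Rightarrow> real" and w :: "nat \<Rightarrow> 'a \<Rightarrow> real" and lam\<delta> :: real
  assumes E: "locally_compact_space (euclidean :: 'a topology)"
    and proc: "standard_Feller_Markov M Px X"
    and U: "compact U" "U \<noteq> {}"
    and B: "\<And>m. compact (B m)" "U \<subseteq> B 0" "\<And>m. B m \<subseteq> B (Suc m)" "(\<Union>m. B m) = UNIV"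
    and A1: "A1 f c U" and A2: "A2 Px X" and A3: "A3 Px X" and A4: "A4 Px X B"
    and \<delta>: "\<delta> > 0"
    and OS: "\<And>m. OS_solution Px X f c U \<delta> (B m) (lam m) (w m)"
    and lim: "lam \<longlonglongrightarrow> lam\<delta>"
    and gt: "lam\<delta> > rate Px X f"
  shows "\<exists>w\<delta>\<in>Cb. (SUP \<xi>\<in>U. w\<delta> \<xi>) = 0 \<and>
    (\<forall>x. w\<delta> x = (SUP \<sigma>\<in>dyadic_stopping_times M Px X \<delta> x.
       ln (integral\<^sup>L (Px x) (\<lambda>\<omega>. case \<sigma> \<omega> of
            enat k \<Rightarrow> exp (integral {0..real k * \<delta>} (\<lambda>s. f (X s \<omega>) - lam\<delta>)
                          + Mop c U w\<delta> (X (real k * \<delta>) \<omega>))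
          | \<infinity> \<Rightarrow> 0))))"
proof -
  have bounded: "bounded (range f)" "bounded ((\<lambda>(x, \<xi>). c x \<xi>) ` (UNIV \<times> U))"
    and continuous: "continuous_on UNIV f" "continuous_on (UNIV \<times> U) (\<lambda>(x, \<xi>). c x \<xi>)"
    and c_nonpos: "\<And>x \<xi>. \<xi> \<in> U \<Longrightarrow> c x \<xi> \<le> 0"
    using A1 unfolding A1_def by blast+
  obtain F where f_le: "\<And>x. \<bar>f x\<bar> \<le> F" using bounded(1) by (auto simp: bounded_iff)
  obtain H where c_le: "\<And>x \<xi>. \<xi> \<in> U \<Longrightarrow> \<bar>c x \<xi>\<bar> \<le> H" using bounded(2) by (auto simp: bounded_iff)
  interpret impulse_control M Px X f F c U H \<delta>
  proof
    show "c x \<xi> \<in> {- H..0}" if "\<xi> \<in> U" for x \<xi>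
      using c_le[OF that, of x] c_nonpos[OF that, of x] by simp
  qed (fact proc A2 continuous f_le U \<delta>)+
  obtain g where g_solution: "OS_solution Px X f c U \<delta> UNIV lam\<delta> g" "(SUP \<xi>\<in>U. g \<xi>) = 0"
    by (rule OS_limit[OF B OS lim gt])
  have "g \<in> Cb" using OS_solutionD(1,2)[OF g_solution(1)] by (simp add: Cb_def)
  with g_solution(2) OS_verification[OF g_solution(1) gt] show ?thesis by blast
qed

end
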